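(* For every $3$-graph $\mathcal{F}$ and every $\eta>0$ there is a constant $c=c(\mathcal{F},\eta)>0$ such that every induced $\mathcal{F}$-free $3$-graph on $n$ vertices contains an $\eta$-homogeneous set of size $c\log n$.
   Context: A $3$-graph is a finite $3$-uniform hypergraph. A $3$-graph $\mathcal{G}$ is induced $\mathcal{F}$-free if it contains no induced copy of $\mathcal{F}$. A set of vertices $W$ in a $3$-graph is $\eta$-homogeneous if $W$ spans either at least $(1-\eta)\binom{|W|}{3}$ edges or at most $\eta\binom{|W|}{3}$ edges. $\log$ denotes the natural logarithm. Rounding issues are ignored (non-integer sizes are understood to be rounded to integers). *)

theory Defs
  imports Complex_Main "HOL-Library.Ramsey"
begin

text \<open>
  A 3-graph is given by its vertex set and its edge set; \<open>[V]\<^bsup>3\<^esup>\<close> is the set of all 3-element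
  subsets of \<open>V\<close>.
\<close>

locale three_graph =
  fixes V :: "'a set" and E :: "'a set set"
  assumes finite_vertices: "finite V"
    and edges_subset: "E \<subseteq> [V]\<^bsup>3\<^esup>"

text \<open>
  An induced copy of \<open>(VF, EF)\<close> in \<open>(V, E)\<close> is the image of an injection of the vertices that
  maps edges to edges and non-edges to non-edges.
\<close>

definition induced_free :: "'b set \<Rightarrow> 'b set set \<Rightarrow> 'a set \<Rightarrow> 'a set set \<Rightarrow> bool" where
  "induced_free VF EF V E \<longleftrightarrow>
     \<not> (\<exists>f. inj_on f VF \<and> f ` VF \<subseteq> V \<and> (\<forall>e \<in> [VF]\<^bsup>3\<^esup>. f ` e \<in> E \<longleftrightarrow> e \<in> EF))"

definition spanned_edges :: "'a set set \<Rightarrow> 'a set \<Rightarrow> nat" where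
  "spanned_edges E W = card (E \<inter> [W]\<^bsup>3\<^esup>)"

definition homogeneous :: "real \<Rightarrow> 'a set set \<Rightarrow> 'a set \<Rightarrow> bool" where
  "homogeneous \<eta> E W \<longleftrightarrow>
     real (spanned_edges E W) \<ge> (1 - \<eta>) * real (card W choose 3) \<or>
     real (spanned_edges E W) \<le> \<eta> * real (card W choose 3)"

end

theory Submission
  imports Defs "HOL-Complex_Analysis.Great_Picard"
begin

text \<open>
  If no constant works, there are counterexamples for constants tending to \<open>0\<close>; pass to a
  subsequence along which the density of every finite pattern converges. By Cauchy-Schwarz, the
  patterns of positive limit density are closed under blow-up. Call a triple of such a pattern
  locked if flipping it makes the limit density vanish, and take a pattern in which the number of
  locked triples among \<open>N\<close> vertices is maximal. An unlocked triple can then be flipped in every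
  extension, and since a blow-up contains for each triple a copy of the pattern meeting the
  \<open>N\<close> vertices in that triple only, the flips are independent. By Ramsey's theorem there are
  either many vertices with all triples unlocked, so that every pattern and in particular the
  forbidden one occurs, or a large set \<open>S\<close> with all triples locked and of one colour.

  In the second case fix the images of the vertices outside \<open>S\<close>. The remaining conditions are
  graph conditions between pairs of vertices of \<open>S\<close>: a positive proportion of the maps on \<open>S\<close>
  are cliques of these graphs, and almost no clique contains a triple of the wrong colour.
  Because only graphs are involved, the pigeonhole argument of Bollobas and Erdos yields parts of
  logarithmic (instead of root-logarithmic) size that are pairwise complete and contain few wrong
  transversal triples. The union of the parts is homogeneous.
\<close>

subsection \<open>Product sets and averaging\<close>

lemma sum_PiE_insert:
  assumes "i \<notin> I"
  shows "(\<Sum>x\<in>PiE (insert i I) T. g x) = (\<Sum>y\<in>T i. \<Sum>x\<in>PiE I T. g (x(i := y)))"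
proof -
  have "(\<Sum>x\<in>PiE (insert i I) T. g x) = (\<Sum>(y, x)\<in>T i \<times> PiE I T. g (x(i := y)))"
    unfolding PiE_insert_eq
    by (subst sum.reindex[OF inj_combinator[OF assms]]) (simp add: case_prod_unfold)
  then show ?thesis by (simp add: sum.cartesian_product)
qed

lemma PiE_upd: "x \<in> PiE I T \<Longrightarrow> y \<in> T i \<Longrightarrow> x(i := y) \<in> PiE (insert i I) T"
  by (auto simp: PiE_iff extensional_def)

lemma card_PiE_restrict:
  assumes "finite A" "B \<subseteq> A"
  shows "card {x \<in> PiE A T. restrict x B \<in> R} = card (PiE B T \<inter> R) * (\<Prod>a\<in>A-B. card (T a))"
proof -
  have "bij_betw (\<lambda>x. (restrict x B, restrict x (A - B))) {x \<in> PiE A T. restrict x B \<in> R}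
          ((PiE B T \<inter> R) \<times> PiE (A - B) T)"
  proof (rule bij_betw_byWitness[where f' = "\<lambda>(y, z) a. if a \<in> B then y a else z a"])
    show "\<forall>x\<in>{x \<in> PiE A T. restrict x B \<in> R}.
        (case (restrict x B, restrict x (A - B)) of (y, z) \<Rightarrow> \<lambda>a. if a \<in> B then y a else z a) = x"
      using assms by (auto simp: fun_eq_iff PiE_iff extensional_def)
    have eq: "restrict (\<lambda>a. if a \<in> B then y a else z a) B = y" if "y \<in> PiE B T" for y z
      using that by (auto simp: fun_eq_iff PiE_iff extensional_def)
    have eq': "restrict (\<lambda>a. if a \<in> B then y a else z a) (A - B) = z" if "z \<in> PiE (A - B) T" for y z
      using that by (auto simp: fun_eq_iff PiE_iff extensional_def)
    show "\<forall>p\<in>(PiE B T \<inter> R) \<times> PiE (A - B) T.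
        (restrict (case p of (y, z) \<Rightarrow> \<lambda>a. if a \<in> B then y a else z a) B,
         restrict (case p of (y, z) \<Rightarrow> \<lambda>a. if a \<in> B then y a else z a) (A - B)) = p"
      by (simp add: eq eq')
    show "(\<lambda>x. (restrict x B, restrict x (A - B))) ` {x \<in> PiE A T. restrict x B \<in> R}
        \<subseteq> (PiE B T \<inter> R) \<times> PiE (A - B) T"
      using assms by (auto simp: PiE_iff extensional_def split: if_splits)
    show "(\<lambda>(y, z) a. if a \<in> B then y a else z a) ` ((PiE B T \<inter> R) \<times> PiE (A - B) T)
        \<subseteq> {x \<in> PiE A T. restrict x B \<in> R}"
      using assms by (auto simp: eq)
  qed
  then have "card {x \<in> PiE A T. restrict x B \<in> R} = card ((PiE B T \<inter> R) \<times> PiE (A - B) T)"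
    by (rule bij_betw_same_card)
  then show ?thesis
    using assms by (simp add: card_cartesian_product card_PiE)
qed

text \<open>Deleting an element of least value cannot push the average below \<open>d\<close>: if
  that value is at most \<open>d\<close>, the rest gains, and otherwise all values exceed
  \<open>d\<close>. Repeated deletion reaches any size \<open>t\<close>.\<close>

lemma ex_subset_sum_ge:
  fixes f :: "'a \<Rightarrow> real" and d :: real
  assumes "finite A" "t \<le> card A" "d * card A \<le> sum f A"
  shows "\<exists>T\<subseteq>A. card T = t \<and> d * t \<le> sum f T"
  using assms
proof (induction "card A - t" arbitrary: A)
  case 0
  then show ?case by auto
next
  case (Suc k)
  then have ne: "A \<noteq> {}" "card A > t" by auto
  obtain a where a: "a \<in> A" "\<And>b. b \<in> A \<Longrightarrow> f a \<le> f b"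
    using Suc.prems(1) ne(1) by (metis arg_min_if_finite(1) arg_min_least)
  let ?A = "A - {a}"
  have sumA: "sum f A = f a + sum f ?A"
    using Suc.prems(1) a(1) by (simp add: sum.remove)
  have cA: "real (card A) = 1 + card ?A"
    using card.remove[OF Suc.prems(1) a(1)] by simp
  have "card ?A * f a \<le> sum f ?A"
    using a(2) by (intro sum_bounded_below) auto
  have "d * card ?A \<le> sum f ?A"
  proof (cases "f a \<le> d")
    case True
    then show ?thesis using Suc.prems(3) sumA cA by (simp add: algebra_simps)
  next
    case False
    then have "d * card ?A \<le> card ?A * f a"
      by (metis linear mult.commute mult_left_mono of_nat_0_le_iff)
    then show ?thesis using \<open>card ?A * f a \<le> sum f ?A\<close> by linarith
  qed
  moreover have "k = card ?A - t" "t \<le> card ?A"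
    using Suc.hyps(2) a(1) Suc.prems(1) by auto
  ultimately obtain T where "T \<subseteq> ?A" "card T = t" "d * t \<le> sum f T"
    using Suc.hyps(1)[of ?A] Suc.prems(1) by auto
  then show ?case by blast
qed

text \<open>The sets \<open>U i\<close> are thinned out one coordinate at a time, by applying
  \<open>ex_subset_sum_ge\<close> to the sums over the sections in which that coordinate is
  fixed.\<close>

lemma ex_subboxes_sum_ge:
  fixes g :: "('i \<Rightarrow> 'a) \<Rightarrow> real"
  assumes "finite I" "\<And>i. i \<in> I \<Longrightarrow> finite (U i) \<and> t \<le> card (U i)"
    and "d * (\<Prod>i\<in>I. real (card (U i))) \<le> (\<Sum>x\<in>PiE I U. g x)"
  shows "\<exists>T. (\<forall>i\<in>I. T i \<subseteq> U i \<and> card (T i) = t) \<and> d * real t ^ card I \<le> (\<Sum>x\<in>PiE I T. g x)"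
  using assms
proof (induction I arbitrary: g d rule: finite_induct)
  case empty
  then show ?case by auto
next
  case (insert i I)
  define G where "G y = (\<Sum>x\<in>PiE I U. g (x(i := y)))" for y
  have "(d * (\<Prod>i\<in>I. real (card (U i)))) * card (U i) \<le> sum G (U i)"
    using insert.prems(2) insert.hyps by (simp add: sum_PiE_insert G_def mult_ac)
  then obtain Ti where Ti: "Ti \<subseteq> U i" "card Ti = t" "(d * (\<Prod>i\<in>I. real (card (U i)))) * t \<le> sum G Ti"
    using ex_subset_sum_ge[of "U i" t] insert.prems(1) by blast
  have "(d * t) * (\<Prod>i\<in>I. real (card (U i))) \<le> (\<Sum>x\<in>PiE I U. \<Sum>y\<in>Ti. g (x(i := y)))"
    using Ti(3) by (subst sum.swap) (simp add: G_def mult_ac)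
  then obtain T where T: "\<forall>i\<in>I. T i \<subseteq> U i \<and> card (T i) = t"
     "(d * t) * real t ^ card I \<le> (\<Sum>x\<in>PiE I T. \<Sum>y\<in>Ti. g (x(i := y)))"
    using insert.IH[of "d * t"] insert.prems(1) by blast
  let ?T = "T(i := Ti)"
  have "PiE I ?T = PiE I T" by (rule PiE_cong) (use insert.hyps in auto)
  then have "(\<Sum>x\<in>PiE (insert i I) ?T. g x) = (\<Sum>x\<in>PiE I T. \<Sum>y\<in>Ti. g (x(i := y)))"
    using insert.hyps by (subst sum_PiE_insert, simp, subst sum.swap) simp
  then have "d * real t ^ card (insert i I) \<le> (\<Sum>x\<in>PiE (insert i I) ?T. g x)"
    using T(2) insert.hyps by (simp add: mult_ac)
  moreover have "\<forall>j\<in>insert i I. ?T j \<subseteq> U j \<and> card (?T j) = t"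
    using T(1) Ti by auto
  ultimately show ?case by blast
qed

text \<open>A reverse Markov inequality: the elements with \<open>q z < d * K\<close> contribute at
  most half of the lower bound \<open>2 * d * K * card V\<close>, and every other element
  contributes at most \<open>K\<close>.\<close>

lemma card_large_values_ge:
  fixes q :: "'a \<Rightarrow> real"
  assumes "finite V" "\<And>z. z \<in> V \<Longrightarrow> q z \<le> K" "0 < K" "0 \<le> d" "2 * d * K * card V \<le> sum q V"
  shows "d * card V \<le> card {z\<in>V. d * K \<le> q z}"
proof -
  let ?L = "{z\<in>V. d * K \<le> q z}"
  have "sum q V \<le> (\<Sum>z\<in>V. d * K + (if z \<in> ?L then K else 0))"
    using assms by (intro sum_mono) (auto intro: add_increasing)
  also have "\<dots> = d * K * card V + K * card ?L"
    using assms(1) by (simp add: sum.distrib mult_ac flip: sum.inter_filter)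
  finally have "K * (d * card V) \<le> K * card ?L"
    using assms(5) by (simp add: algebra_simps)
  then show ?thesis using assms(3) by simp
qed

lemma ex_large_fibre:
  assumes "finite L" "f ` L \<subseteq> R" "finite R" "card R * t \<le> card L" "R \<noteq> {}"
  shows "\<exists>r\<in>R. t \<le> card {z\<in>L. f z = r}"
proof (rule ccontr)
  assume *: "\<not> ?thesis"
  have "card L = (\<Sum>r\<in>R. card {z\<in>L. f z = r})"
    using assms(1-3) by (subst card_eq_sum, subst sum.group[symmetric]) auto
  also have "\<dots> < (\<Sum>r\<in>R. t)"
    using * assms(3,5) by (intro sum_strict_mono) (auto simp: not_le)
  finally show False using assms(4) by simp
qed

subsection \<open>Blow-ups of logarithmic size\<close>

text \<open>The weight \<open>g\<close> is bounded from above only, which allows for the indicator of the cliques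
  minus a number of defects.\<close>

lemma log_blowup:
  fixes J :: "'i set" and d :: real
  assumes "finite J" "0 < d"
  shows "\<exists>c>0. \<exists>d'>0. \<forall>(V :: 'a set) P g t. finite V \<longrightarrow>
     (\<forall>x\<in>PiE J (\<lambda>_. V). g x \<le> (1::real)) \<longrightarrow>
     (\<forall>x\<in>PiE J (\<lambda>_. V). g x \<noteq> 0 \<longrightarrow> (\<forall>a\<in>J. \<forall>b\<in>J. a \<noteq> b \<longrightarrow> P a b (x a) (x b))) \<longrightarrow>
     d * real (card V) ^ card J \<le> (\<Sum>x\<in>PiE J (\<lambda>_. V). g x) \<longrightarrow>
     real t \<le> c * ln (card V) \<longrightarrow>
     (\<exists>T. (\<forall>a\<in>J. T a \<subseteq> V \<and> card (T a) = t) \<and>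
        (\<forall>a\<in>J. \<forall>b\<in>J. a \<noteq> b \<longrightarrow> (\<forall>u\<in>T a. \<forall>v\<in>T b. P a b u v)) \<and>
        d' * real t ^ card J \<le> (\<Sum>x\<in>PiE J T. g x))"
  using assms(1)
proof (induction J rule: finite_induct)
  case empty
  show ?case
  proof (rule exI[of _ 1], rule conjI[OF zero_less_one], rule exI[of _ d], rule conjI[OF assms(2)], intro allI impI)
    fix V :: "'a set" and P :: "'i \<Rightarrow> 'i \<Rightarrow> 'a \<Rightarrow> 'a \<Rightarrow> bool" and g :: "('i \<Rightarrow> 'a) \<Rightarrow> real" and t :: nat
    assume "d * real (card V) ^ card {} \<le> (\<Sum>x\<in>PiE {} (\<lambda>_. V). g x)"
    then show "\<exists>T. (\<forall>a\<in>{}. T a \<subseteq> V \<and> card (T a) = t) \<and>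
        (\<forall>a\<in>{}. \<forall>b\<in>{}. a \<noteq> b \<longrightarrow> (\<forall>u\<in>T a. \<forall>v\<in>T b. P a b u v)) \<and>
        d * real t ^ card {} \<le> (\<Sum>x\<in>PiE {} T. g x)"
      by simp
  qed
next
  case (insert j I)
  from insert.IH obtain c d' where c: "c > 0" and d': "d' > (0::real)" and
    IH: "\<forall>(V :: 'a set) P g t. finite V \<longrightarrow>
     (\<forall>x\<in>PiE I (\<lambda>_. V). g x \<le> (1::real)) \<longrightarrow>
     (\<forall>x\<in>PiE I (\<lambda>_. V). g x \<noteq> 0 \<longrightarrow> (\<forall>a\<in>I. \<forall>b\<in>I. a \<noteq> b \<longrightarrow> P a b (x a) (x b))) \<longrightarrow>
     d * real (card V) ^ card I \<le> (\<Sum>x\<in>PiE I (\<lambda>_. V). g x) \<longrightarrow>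
     real t \<le> c * ln (card V) \<longrightarrow>
     (\<exists>T. (\<forall>a\<in>I. T a \<subseteq> V \<and> card (T a) = t) \<and>
        (\<forall>a\<in>I. \<forall>b\<in>I. a \<noteq> b \<longrightarrow> (\<forall>u\<in>T a. \<forall>v\<in>T b. P a b u v)) \<and>
        d' * real t ^ card I \<le> (\<Sum>x\<in>PiE I T. g x))"
    by (elim exE conjE)
  \<comment> \<open>\<open>K\<close> bounds the ratio of \<open>t'\<close>, the size of the
    auxiliary parts for \<open>I\<close>, to \<open>t\<close>. The two terms of \<open>c'\<close>
    then ensure \<open>t' \<le> c * ln n\<close>, as the induction hypothesis demands, and
    \<open>t' * (card I + 1) \<le> ln n\<close>, as the pigeonhole step demands.\<close>
  define K where "K = 2 / d' + 1"
  have K: "K > 0" using d' by (simp add: K_def add_pos_pos)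
  define c' where "c' = min (c / K) (1 / ((card I + 1) * K))"
  have c': "c' > 0" using c K by (simp add: c'_def)
  have "\<exists>T. (\<forall>a\<in>insert j I. T a \<subseteq> V \<and> card (T a) = t) \<and>
        (\<forall>a\<in>insert j I. \<forall>b\<in>insert j I. a \<noteq> b \<longrightarrow> (\<forall>u\<in>T a. \<forall>v\<in>T b. P a b u v)) \<and>
        (d' / 2) * real t ^ card (insert j I) \<le> (\<Sum>x\<in>PiE (insert j I) T. g x)"
    if V: "finite V" and g1: "\<forall>x\<in>PiE (insert j I) (\<lambda>_. V). g x \<le> (1::real)" and
       gP: "\<forall>x\<in>PiE (insert j I) (\<lambda>_. V). g x \<noteq> 0 \<longrightarrow>
              (\<forall>a\<in>insert j I. \<forall>b\<in>insert j I. a \<noteq> b \<longrightarrow> P a b (x a) (x b))" and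
       gs: "d * real (card V) ^ card (insert j I) \<le> (\<Sum>x\<in>PiE (insert j I) (\<lambda>_. V). g x)" and
       t: "real t \<le> c' * ln (card V)"
     for V :: "'a set" and P g t
  proof (cases "t = 0")
    case True
    have "PiE (insert j I) (\<lambda>_. {}) = ({} :: ('i \<Rightarrow> 'a) set)" by (auto simp: PiE_eq_empty_iff)
    then show ?thesis using True insert.hyps by (intro exI[of _ "\<lambda>_. {}"]) auto
  next
    case t0: False
    define n where "n = real (card V)"
    have "ln n > 0" 
    proof -
      have "0 < c' * ln n" using t t0 unfolding n_def by (smt (verit) of_nat_0_less_iff gr0I)
      then show ?thesis using c' by (simp add: zero_less_mult_iff)
    qed
    then have n: "n > 1" unfolding n_def by (cases "card V") (auto simp: ln_gt_zero_iff)
    have fU: "finite W" if "W \<subseteq> V" for W using V that finite_subset by blast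
    \<comment> \<open>Averaging over the coordinate \<open>j\<close> preserves the upper bound
      \<open>1\<close>, the pair conditions inside \<open>I\<close> and the lower bound
      \<open>d\<close> on the mean, so the induction hypothesis applies to \<open>h\<close>. It is
      used for parts of the larger size \<open>t'\<close>, which are thinned out at the end.\<close>
    define h where "h x = (\<Sum>z\<in>V. g (x(j := z))) / n" for x
    define t' where "t' = nat \<lceil>2 / d' * t\<rceil>"
    have t'1: "2 / d' * t \<le> t'" unfolding t'_def using d' by linarith
    have "t' \<le> 2 / d' * t + 1" unfolding t'_def using d' by (simp add: of_nat_nat)
    also have "\<dots> \<le> K * t" using t0 by (simp add: K_def algebra_simps)
    finally have t'2: "t' \<le> K * t" .
    have t'3: "t' > 0" unfolding t'_def using d' t0 by simp
    have "t' \<le> K * (c' * ln n)" using t'2 t K unfolding n_def by (smt (verit) mult_left_mono)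
    moreover have "K * c' \<le> c"
    proof -
      have "c' \<le> c / K" by (simp add: c'_def)
      then show ?thesis using K by (simp add: field_simps)
    qed
    moreover have "K * c' * (card I + 1) \<le> 1"
    proof -
      have "c' \<le> 1 / ((card I + 1) * K)" by (simp add: c'_def)
      then have "c' * ((card I + 1) * K) \<le> 1"
        using K by (subst (asm) pos_le_divide_eq) (auto intro: mult_pos_pos)
      then show ?thesis by (simp add: mult_ac)
    qed
    ultimately have "t' \<le> (K * c') * ln n" "(K * c') * ln n \<le> c * ln n"
      "(K * c' * (card I + 1)) * ln n \<le> 1 * ln n"
      using \<open>ln n > 0\<close> by (auto simp only: mult.assoc[symmetric] intro: mult_right_mono[OF _ less_imp_le])
    then have t'c: "t' \<le> c * ln n" and t'I: "t' * (card I + 1) \<le> ln n"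
    proof -
      have "t' * real (card I + 1) \<le> ((K * c') * ln n) * real (card I + 1)"
        using \<open>t' \<le> (K * c') * ln n\<close> by (intro mult_right_mono) auto
      also have "\<dots> \<le> ln n"
        using \<open>(K * c' * (card I + 1)) * ln n \<le> 1 * ln n\<close> by (simp add: mult_ac)
      finally show "t' * (card I + 1) \<le> ln n" by (simp add: algebra_simps)
    qed linarith
    have upd: "x(j := z) \<in> PiE (insert j I) (\<lambda>_. V)" if "x \<in> PiE I (\<lambda>_. V)" "z \<in> V" for x z
      using that by (intro PiE_upd) auto
    have h1: "h x \<le> 1" if "x \<in> PiE I (\<lambda>_. V)" for x
    proof -
      have "(\<Sum>z\<in>V. g (x(j := z))) \<le> (\<Sum>z\<in>V. 1)"
        using that g1 upd by (intro sum_mono) blast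
      then show ?thesis using n unfolding h_def by (simp add: n_def)
    qed
    have hP: "\<forall>a\<in>I. \<forall>b\<in>I. a \<noteq> b \<longrightarrow> P a b (x a) (x b)" if x: "x \<in> PiE I (\<lambda>_. V)" and hx: "h x \<noteq> 0" for x
    proof -
      obtain z where z: "z \<in> V" "g (x(j := z)) \<noteq> 0"
        using hx unfolding h_def by (metis (no_types, lifting) div_0 sum.neutral)
      have "\<forall>a\<in>insert j I. \<forall>b\<in>insert j I. a \<noteq> b \<longrightarrow> P a b ((x(j := z)) a) ((x(j := z)) b)"
        using gP upd[OF x z(1)] z(2) by blast
      then show ?thesis using insert.hyps(2) by (metis fun_upd_other insertCI)
    qed
    have "(\<Sum>x\<in>PiE I (\<lambda>_. V). h x) * n = (\<Sum>x\<in>PiE (insert j I) (\<lambda>_. V). g x)"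
      using n insert.hyps by (simp add: sum_PiE_insert h_def flip: sum_divide_distrib) (rule sum.swap)
    then have "d * n ^ card I * n \<le> (\<Sum>x\<in>PiE I (\<lambda>_. V). h x) * n"
      using gs insert.hyps by (simp add: n_def mult_ac)
    then have hs: "d * n ^ card I \<le> (\<Sum>x\<in>PiE I (\<lambda>_. V). h x)" using n by simp
    have "\<exists>T. (\<forall>a\<in>I. T a \<subseteq> V \<and> card (T a) = t') \<and>
        (\<forall>a\<in>I. \<forall>b\<in>I. a \<noteq> b \<longrightarrow> (\<forall>u\<in>T a. \<forall>v\<in>T b. P a b u v)) \<and>
        d' * real t' ^ card I \<le> (\<Sum>x\<in>PiE I T. h x)"
      using h1 hP hs t'c unfolding n_def
      by (intro IH[THEN spec, THEN spec, THEN spec, THEN spec, THEN mp, THEN mp, THEN mp, THEN mp, THEN mp] V) blast+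
    then obtain T where T: "\<forall>a\<in>I. T a \<subseteq> V \<and> card (T a) = t'"
        "\<forall>a\<in>I. \<forall>b\<in>I. a \<noteq> b \<longrightarrow> (\<forall>u\<in>T a. \<forall>v\<in>T b. P a b u v)"
        "d' * real t' ^ card I \<le> (\<Sum>x\<in>PiE I T. h x)"
      by (elim exE conjE)
    \<comment> \<open>\<open>q z\<close> is the weight of \<open>z\<close> over the box
      \<open>T\<close>, and \<open>N z a\<close> is the portion of \<open>T a\<close> compatible
      with \<open>z\<close>. Since \<open>g\<close> vanishes off the cliques, only the smaller box
      \<open>PiE I (N z)\<close> contributes to \<open>q z\<close>.\<close>
    define q where "q z = (\<Sum>x\<in>PiE I T. g (x(j := z)))" for z
    define N where "N z a = {u \<in> T a. P a j u z \<and> P j a z u}" for z a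
    have TV: "x \<in> PiE I T \<Longrightarrow> x \<in> PiE I (\<lambda>_. V)" for x using T(1) by (auto simp: PiE_iff)
    have fT: "finite (PiE I T)" using T(1) insert.hyps(1) fU by (intro finite_PiE) auto
    have qN: "q z = (\<Sum>x\<in>PiE I (N z). g (x(j := z)))" if "z \<in> V" for z
      unfolding q_def
    proof (rule sum.mono_neutral_right[OF fT])
      show "PiE I (N z) \<subseteq> PiE I T" by (auto simp: PiE_iff N_def)
      show "\<forall>x\<in>PiE I T - PiE I (N z). g (x(j := z)) = 0"
      proof (rule ballI, rule ccontr)
        fix x assume x: "x \<in> PiE I T - PiE I (N z)" and "g (x(j := z)) \<noteq> 0"
        then have "\<forall>a\<in>insert j I. \<forall>b\<in>insert j I. a \<noteq> b \<longrightarrow> P a b ((x(j := z)) a) ((x(j := z)) b)"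
          using gP upd[OF TV that] by blast
        then have "P a j (x a) z \<and> P j a z (x a)" if "a \<in> I" for a
          using insert.hyps(2) that by (metis fun_upd_other fun_upd_same insertCI)
        then have "x \<in> PiE I (N z)" using x by (auto simp: N_def PiE_iff)
        then show False using x by blast
      qed
    qed
    have cN: "card (N z a) \<le> t'" if "a \<in> I" for z a
      using T(1) that fU card_mono[of "T a" "N z a"] by (auto simp: N_def)
    have qle: "q z \<le> (\<Prod>a\<in>I. real (card (N z a)))" if "z \<in> V" for z
    proof -
      have "q z \<le> (\<Sum>x\<in>PiE I (N z). 1)"
        unfolding qN[OF that]
      proof (rule sum_mono)
        fix x assume "x \<in> PiE I (N z)"
        then have "x \<in> PiE I T" by (auto simp: PiE_iff N_def)
        then show "g (x(j := z)) \<le> 1" using g1 upd[OF TV that] by blast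
      qed
      then show ?thesis using insert.hyps(1) by (simp add: card_PiE)
    qed
    \<comment> \<open>A single small \<open>N z a\<close> already makes \<open>q z\<close> small.
      Hence \<open>q z \<ge> d' / 2 * t' ^ card I\<close> forces every \<open>N z a\<close> to have
      at least \<open>d' / 2 * t' \<ge> t\<close> elements.\<close>
    have qle1: "q z \<le> real (card (N z a)) * t' ^ (card I - 1)" if "z \<in> V" "a \<in> I" for z a
    proof -
      have "(\<Prod>b\<in>I. real (card (N z b))) = real (card (N z a)) * (\<Prod>b\<in>I-{a}. real (card (N z b)))"
        using that insert.hyps(1) by (simp add: prod.remove)
      also have "\<dots> \<le> real (card (N z a)) * (\<Prod>b\<in>I-{a}. real t')"
        using cN by (intro mult_left_mono prod_mono) auto
      finally show ?thesis using qle[OF that(1)] that insert.hyps(1) by simp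
    qed
    have qleK: "q z \<le> real t' ^ card I" if "z \<in> V" for z
    proof -
      have "(\<Prod>b\<in>I. real (card (N z b))) \<le> (\<Prod>b\<in>I. real t')"
        using cN by (intro prod_mono) auto
      then show ?thesis using qle[OF that] by simp
    qed
    define L where "L = {z\<in>V. d' / 2 * real t' ^ card I \<le> q z}"
    have "sum q V = n * (\<Sum>x\<in>PiE I T. h x)"
      unfolding q_def h_def using n by (simp add: sum_divide_distrib[symmetric]) (rule sum.swap)
    then have "2 * (d' / 2) * real t' ^ card I * card V \<le> sum q V"
      using T(3) n unfolding n_def by (simp add: mult.commute)
    then have L1: "d' / 2 * n \<le> card L"
      using card_large_values_ge[of V q "real t' ^ card I" "d' / 2"] V qleK d' t'3
      unfolding L_def n_def by simp
    \<comment> \<open>The pigeonholes are the families of subsets of the parts \<open>T a\<close>;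
      there are only \<open>2 ^ (t' * card I)\<close> of them because the parts have logarithmic
      size. As \<open>L\<close> has at least \<open>d' / 2 * n\<close> elements, some
      \<open>t\<close> of them share the same family \<open>N z\<close>.\<close>
    define R where "R = PiE I (\<lambda>a. Pow (T a))"
    have cR: "card R = 2 ^ (t' * card I)"
    proof -
      have "card R = (\<Prod>a\<in>I. 2 ^ t')"
        unfolding R_def using insert.hyps(1) T(1) fU
        by (subst card_PiE) (auto intro!: prod.cong simp: card_Pow)
      then show ?thesis by (simp add: power_mult)
    qed
    have "real (2 ^ (t' * (card I + 1))) = exp (real (t' * (card I + 1)) * ln 2)"
      by (subst exp_of_nat_mult) simp
    also have "\<dots> \<le> exp (real (t' * (card I + 1)))"
      using ln_2_less_1 by (simp add: mult_left_le)
    also have "\<dots> \<le> exp (ln n)" using t'I by simp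
    also have "\<dots> = n" using n by simp
    finally have pw: "2 ^ (t' * (card I + 1)) \<le> n" by simp
    have "real t \<le> d' / 2 * t'" using t'1 d' by (simp add: field_simps)
    also have "\<dots> \<le> d' / 2 * 2 ^ t'"
      using d' by (intro mult_left_mono) (auto simp: less_imp_le)
    finally have "real (card R) * t \<le> 2 ^ (t' * card I) * (d' / 2 * 2 ^ t')"
      unfolding cR by (simp add: mult_left_mono)
    also have "\<dots> = d' / 2 * 2 ^ (t' * (card I + 1))" by (simp add: power_add mult_ac)
    also have "\<dots> \<le> d' / 2 * n" using pw d' by (intro mult_left_mono) auto
    finally have "real (card R * t) \<le> card L" using L1 by simp
    then have cRL: "card R * t \<le> card L" by linarith
    have "finite L" using V unfolding L_def by simp
    moreover have "(\<lambda>z. restrict (N z) I) ` L \<subseteq> R" unfolding R_def N_def by auto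
    moreover have "finite R" using cR by (metis card.infinite power_not_zero zero_neq_numeral)
    moreover have "R \<noteq> {}" using cR by auto
    ultimately obtain r where r: "r \<in> R" "t \<le> card {z\<in>L. restrict (N z) I = r}"
      using ex_large_fibre[of L _ R t] cRL by blast
    obtain Tj where Tj: "Tj \<subseteq> {z\<in>L. restrict (N z) I = r}" "card Tj = t"
      using r(2) by (meson obtain_subset_with_card_n)
    have TjN: "N z a = r a" if "z \<in> Tj" "a \<in> I" for z a using Tj(1) that by force
    have TjV: "Tj \<subseteq> V" using Tj(1) unfolding L_def by auto
    have TjP: "PiE I (N z) = PiE I r" if "z \<in> Tj" for z
      by (rule PiE_cong) (use TjN that in auto)
    obtain z0 where z0: "z0 \<in> Tj" using Tj(2) t0 by fastforce
    have rT: "r a \<subseteq> T a" if "a \<in> I" for a using r(1) that unfolding R_def by auto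
    have cr: "t \<le> card (r a)" if "a \<in> I" for a
    proof -
      have "d' / 2 * real t' ^ card I \<le> real (card (r a)) * t' ^ (card I - 1)"
        using qle1[of z0 a] z0 TjV Tj(1) that TjN unfolding L_def by fastforce
      moreover have "real t' ^ card I = real t' * t' ^ (card I - 1)"
        using that insert.hyps(1) power_minus_mult[of "card I" "real t'"]
        by (cases "I = {}") (auto simp: card_gt_0_iff mult.commute)
      ultimately have "d' / 2 * t' \<le> card (r a)" using t'3 by simp
      then show ?thesis using \<open>real t \<le> d' / 2 * t'\<close> by linarith
    qed
    have frr: "finite (r a)" if "a \<in> I" for a using rT[OF that] T(1) that fU finite_subset by metis
    \<comment> \<open>Summed over \<open>Tj\<close>, the box of the common neighbourhoods
      \<open>r a\<close> has weight at least \<open>t * (d' / 2) * t' ^ card I\<close>. Each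
      \<open>r a\<close> has at most \<open>t'\<close> elements, so the mean over this box is at
      least \<open>t * (d' / 2)\<close>, which survives shrinking every \<open>r a\<close> to size
      \<open>t\<close>.\<close>
    have "(t * (d' / 2)) * (\<Prod>a\<in>I. real (card (r a))) \<le> (t * (d' / 2)) * real t' ^ card I"
    proof -
      have "(\<Prod>a\<in>I. real (card (r a))) \<le> (\<Prod>a\<in>I. real t')"
        using cN[of _ z0] TjN[OF z0] by (intro prod_mono) auto
      then show ?thesis using d' by (intro mult_left_mono) auto
    qed
    also have "\<dots> = (\<Sum>z\<in>Tj. d' / 2 * real t' ^ card I)" using Tj(2) by simp
    also have "\<dots> \<le> (\<Sum>z\<in>Tj. q z)" using Tj(1) unfolding L_def by (intro sum_mono) auto
    also have "\<dots> = (\<Sum>z\<in>Tj. \<Sum>x\<in>PiE I r. g (x(j := z)))"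
      using qN TjV TjP by (intro sum.cong) auto
    also have "\<dots> = (\<Sum>x\<in>PiE I r. \<Sum>z\<in>Tj. g (x(j := z)))" by (rule sum.swap)
    finally obtain T' where T': "\<forall>a\<in>I. T' a \<subseteq> r a \<and> card (T' a) = t"
       "(t * (d' / 2)) * real t ^ card I \<le> (\<Sum>x\<in>PiE I T'. \<Sum>z\<in>Tj. g (x(j := z)))"
      using ex_subboxes_sum_ge[of I r t "t * (d' / 2)" "\<lambda>x. \<Sum>z\<in>Tj. g (x(j := z))"]
        insert.hyps(1) cr frr by blast
    define S where "S = T'(j := Tj)"
    have SI: "S a = T' a" if "a \<in> I" for a using that insert.hyps(2) by (auto simp: S_def)
    have Sj: "S j = Tj" by (simp add: S_def)
    have "PiE I S = PiE I T'" by (rule PiE_cong) (simp add: SI)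
    then have "(\<Sum>x\<in>PiE (insert j I) S. g x) = (\<Sum>x\<in>PiE I T'. \<Sum>z\<in>Tj. g (x(j := z)))"
      using insert.hyps by (subst sum_PiE_insert, simp, subst sum.swap) (simp add: Sj)
    then have "(d' / 2) * real t ^ card (insert j I) \<le> (\<Sum>x\<in>PiE (insert j I) S. g x)"
      using T'(2) insert.hyps by (simp add: mult_ac)
    moreover have "\<forall>a\<in>insert j I. S a \<subseteq> V \<and> card (S a) = t"
    proof
      fix a assume "a \<in> insert j I"
      then consider "a = j" | "a \<in> I" by blast
      then show "S a \<subseteq> V \<and> card (S a) = t"
      proof cases
        case 1
        then show ?thesis using Sj Tj(2) TjV by simp
      next
        case 2
        then have "S a \<subseteq> r a" "r a \<subseteq> T a" "T a \<subseteq> V" "card (S a) = t"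
          using SI T'(1) rT T(1) by auto
        then show ?thesis by blast
      qed
    qed
    moreover have "P a j u v \<and> P j a v u" if "a \<in> I" "u \<in> S a" "v \<in> S j" for a u v
    proof -
      have "u \<in> N v a" using that SI Sj T'(1) TjN[of v a] by auto
      then show ?thesis by (simp add: N_def)
    qed
    moreover have "P a b u v" if "a \<in> I" "b \<in> I" "a \<noteq> b" "u \<in> S a" "v \<in> S b" for a b u v
    proof -
      have "u \<in> T a" "v \<in> T b" using that SI T'(1) rT by blast+
      then show ?thesis using that T(2) by blast
    qed
    ultimately have "(\<forall>a\<in>insert j I. S a \<subseteq> V \<and> card (S a) = t) \<and>
        (\<forall>a\<in>insert j I. \<forall>b\<in>insert j I. a \<noteq> b \<longrightarrow> (\<forall>u\<in>S a. \<forall>v\<in>S b. P a b u v)) \<and>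
        (d' / 2) * real t ^ card (insert j I) \<le> (\<Sum>x\<in>PiE (insert j I) S. g x)"
      by blast
    then show ?thesis by blast
  qed
  note * = this
  show ?case
    by (rule exI[of _ c'], rule conjI[OF c'], rule exI[of _ "d' / 2"],
        rule conjI[OF half_gt_zero[OF d']], intro allI impI, rule *)
qed

subsection \<open>Densities of patterns\<close>

text \<open>Maps need not be injective, which lets twins be added without correction terms; in a
  large \<open>V\<close> the non-injective maps are a negligible proportion. Of \<open>H\<close>,
  only the triples of \<open>A\<close> matter.\<close>

definition occurrences :: "'a set \<Rightarrow> 'a set set \<Rightarrow> 'i set \<Rightarrow> 'i set set \<Rightarrow> ('i \<Rightarrow> 'a) set" where
  "occurrences V E A H = {x \<in> PiE A (\<lambda>_. V). \<forall>e\<in>[A]\<^bsup>3\<^esup>. x ` e \<in> E \<longleftrightarrow> e \<in> H}"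

definition pattern_density :: "'a set \<Rightarrow> 'a set set \<Rightarrow> 'i set \<Rightarrow> 'i set set \<Rightarrow> real" where
  "pattern_density V E A H = card (occurrences V E A H) / card V ^ card A"

lemma occurrences_subset: "occurrences V E A H \<subseteq> PiE A (\<lambda>_. V)"
  by (auto simp: occurrences_def)

lemma finite_occurrences: "finite V \<Longrightarrow> finite A \<Longrightarrow> finite (occurrences V E A H)"
  by (rule finite_subset[OF occurrences_subset]) (simp add: finite_PiE)

lemma occurrences_cong:
  "(\<And>e. e \<in> [A]\<^bsup>3\<^esup> \<Longrightarrow> e \<in> H \<longleftrightarrow> e \<in> H') \<Longrightarrow> occurrences V E A H = occurrences V E A H'"
  by (auto simp: occurrences_def)

lemma nsets_image: "inj_on g A \<Longrightarrow> e \<in> [A]\<^bsup>k\<^esup> \<Longrightarrow> g ` A \<subseteq> B \<Longrightarrow> g ` e \<in> [B]\<^bsup>k\<^esup>"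
  by (auto simp: nsets_def card_image inj_on_subset)

lemma restrict_occurrences:
  assumes "x \<in> occurrences V E A H" "B \<subseteq> A"
  shows "restrict x B \<in> occurrences V E B H"
proof -
  have "restrict x B ` e = x ` e" if "e \<in> [B]\<^bsup>3\<^esup>" for e
    using that by (auto simp: nsets_def intro!: image_cong)
  then show ?thesis
    using assms nsets_mono[OF assms(2), of 3] by (auto simp: occurrences_def PiE_iff subset_iff)
qed

lemma pattern_density_le_1: "finite V \<Longrightarrow> finite A \<Longrightarrow> pattern_density V E A H \<le> 1"
proof -
  assume fin: "finite V" "finite A"
  then have "card (occurrences V E A H) \<le> card V ^ card A"
    using card_mono[OF _ occurrences_subset, of A V E H] by (simp add: finite_PiE card_PiE)
  then have "real (card (occurrences V E A H)) \<le> real (card V) ^ card A"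
    by (metis of_nat_le_iff of_nat_power)
  then show ?thesis unfolding pattern_density_def
    by (cases "real (card V) ^ card A = 0") (auto simp: divide_le_eq_1 order_le_less)
qed

lemma pattern_density_nonneg: "0 \<le> pattern_density V E A H"
  by (simp add: pattern_density_def)

text \<open>An occurrence on \<open>A\<close> restricts to one on the image of \<open>g\<close>, and
  there are at most \<open>card V\<close> choices for each of the remaining vertices. Composition
  with \<open>g\<close> renames the vertices.\<close>

lemma pattern_density_pullback:
  assumes "finite V" "V \<noteq> {}" "finite A" "inj_on g B" "g ` B \<subseteq> A"
  shows "pattern_density V E A H \<le> pattern_density V E B {e. g ` e \<in> H}"
proof -
  let ?n = "card V" and ?B = "g ` B" and ?O = "occurrences V E"
  have n: "real ?n > 0" using assms by (simp add: card_gt_0_iff)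
  have fB: "finite B" using assms finite_subset inj_on_finite by blast
  have "?O A H \<subseteq> {x \<in> PiE A (\<lambda>_. V). restrict x ?B \<in> ?O ?B H}"
    using restrict_occurrences[OF _ assms(5)] occurrences_subset by blast
  then have "card (?O A H) \<le> card {x \<in> PiE A (\<lambda>_. V). restrict x ?B \<in> ?O ?B H}"
    using assms by (intro card_mono) (auto simp: finite_PiE)
  also have "\<dots> = card (?O ?B H) * ?n ^ card (A - ?B)"
    using assms by (subst card_PiE_restrict) (auto simp: occurrences_subset Int_absorb1)
  finally have 1: "card (?O A H) \<le> card (?O ?B H) * ?n ^ card (A - ?B)" .
  have 2: "card (?O ?B H) \<le> card (?O B {e. g ` e \<in> H})"
  proof (rule card_inj_on_le)
    show "inj_on (\<lambda>x. restrict (x \<circ> g) B) (?O ?B H)"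
    proof (rule inj_onI)
      fix x y assume xy: "x \<in> ?O ?B H" "y \<in> ?O ?B H" and eq: "restrict (x \<circ> g) B = restrict (y \<circ> g) B"
      have "x (g b) = y (g b)" if "b \<in> B" for b
        using fun_cong[OF eq, of b] that by simp
      then show "x = y"
        using xy by (intro PiE_ext[of x ?B _ y]) (auto simp: occurrences_def)
    qed
    show "(\<lambda>x. restrict (x \<circ> g) B) ` ?O ?B H \<subseteq> ?O B {e. g ` e \<in> H}"
    proof (rule image_subsetI)
      fix x assume x: "x \<in> ?O ?B H"
      have "restrict (x \<circ> g) B ` e = x ` g ` e" if "e \<in> [B]\<^bsup>3\<^esup>" for e
        using that by (auto simp: nsets_def image_image intro!: image_cong)
      moreover have "g ` e \<in> [?B]\<^bsup>3\<^esup>" if "e \<in> [B]\<^bsup>3\<^esup>" for e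
        using nsets_image[OF assms(4) that] by blast
      ultimately show "restrict (x \<circ> g) B \<in> ?O B {e. g ` e \<in> H}"
        using x by (auto simp: occurrences_def PiE_iff)
    qed
    show "finite (?O B {e. g ` e \<in> H})" using assms fB finite_occurrences by blast
  qed
  have cB: "card ?B = card B" using assms(4) by (rule card_image)
  have cA: "card A = card B + card (A - ?B)"
    using assms cB card_mono[OF assms(3,5)] by (simp add: card_Diff_subset finite_subset)
  have "real (card (?O A H)) \<le> card (?O B {e. g ` e \<in> H}) * ?n ^ card (A - ?B)"
    using 1 2 by (meson le_trans mult_le_mono1 of_nat_mono)
  then show ?thesis
    unfolding pattern_density_def cA power_add using n
    by (simp add: field_simps)
qed

text \<open>The new vertex \<open>b\<close> is a twin of \<open>a\<close>: both \<open>A\<close> and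
  its copy with \<open>b\<close> in place of \<open>a\<close> carry \<open>H\<close>. Triples
  containing \<open>a\<close> and \<open>b\<close> are left open, hence a set of patterns.\<close>

definition twin_patterns :: "'i set \<Rightarrow> 'i set set \<Rightarrow> 'i \<Rightarrow> 'i \<Rightarrow> 'i set set set" where
  "twin_patterns A H a b = {H' \<in> Pow ([insert b A]\<^bsup>3\<^esup>). \<forall>e\<in>[A]\<^bsup>3\<^esup>. (e \<in> H' \<longleftrightarrow> e \<in> H) \<and> (id(a := b) ` e \<in> H' \<longleftrightarrow> e \<in> H)}"

text \<open>Cauchy-Schwarz: if a map \<open>x\<close> on \<open>A - {a}\<close> has
  \<open>r x\<close> completions to an occurrence, then the sum of \<open>r x\<close> counts the
  occurrences, and the sum of the squares counts the pairs of completions, that is, the maps in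
  \<open>Z\<close> with \<open>b\<close> as a second copy of \<open>a\<close>.\<close>

lemma pattern_density_twin:
  assumes "finite V" "V \<noteq> {}" "finite A" "a \<in> A" "b \<notin> A"
  shows "(pattern_density V E A H)\<^sup>2 \<le> (\<Sum>H'\<in>twin_patterns A H a b. pattern_density V E (insert b A) H')"
proof -
  let ?n = "card V" and ?O = "occurrences V E A H" and ?P = "\<lambda>A. PiE A (\<lambda>_. V)"
  define A0 where "A0 = A - {a}"
  have A: "A = insert a A0" "a \<notin> A0" using assms(4) by (auto simp: A0_def)
  have fin: "finite A0" "finite (?P A)" "finite (?P A0)" "finite (?P (insert b A))"
    using assms by (auto simp: A0_def finite_PiE)
  have n: "real ?n > 0" using assms by (simp add: card_gt_0_iff)
  define r where "r x = (\<Sum>u\<in>V. of_bool (x(a := u) \<in> ?O) :: real)" for x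
  define Z where "Z = {z \<in> ?P (insert b A). z(b := undefined) \<in> ?O \<and> z(a := z b, b := undefined) \<in> ?O}"
  have "real (card ?O) = (\<Sum>x\<in>?P A. of_bool (x \<in> ?O))"
    using fin occurrences_subset[of V E A H] by (simp add: Int_absorb1)
  also have "\<dots> = (\<Sum>x\<in>?P A0. r x)"
    unfolding A(1) r_def by (subst sum_PiE_insert[OF A(2)]) (rule sum.swap)
  finally have cO: "real (card ?O) = (\<Sum>x\<in>?P A0. r x)" .
  have upd: "(w(b := v))(b := undefined) = w" "(w(b := v))(a := v, b := undefined) = w(a := v)"
    if "w \<in> ?P A" for w v
    using that assms(4,5) by (auto simp: fun_eq_iff PiE_iff extensional_def)
  have "real (card Z) = (\<Sum>z\<in>?P (insert b A). of_bool (z(b := undefined) \<in> ?O \<and> z(a := z b, b := undefined) \<in> ?O))"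
    using fin by (simp add: Z_def Int_def)
  also have "\<dots> = (\<Sum>v\<in>V. \<Sum>w\<in>?P A. of_bool (w \<in> ?O \<and> w(a := v) \<in> ?O))"
    using upd by (subst sum_PiE_insert[OF assms(5)]) (intro sum.cong, auto)
  also have "\<dots> = (\<Sum>v\<in>V. \<Sum>u\<in>V. \<Sum>x\<in>?P A0. of_bool (x(a := u) \<in> ?O) * of_bool (x(a := v) \<in> ?O))"
    unfolding A(1) by (subst sum_PiE_insert[OF A(2)]) (simp add: of_bool_conj)
  also have "\<dots> = (\<Sum>v\<in>V. \<Sum>x\<in>?P A0. \<Sum>u\<in>V. of_bool (x(a := u) \<in> ?O) * of_bool (x(a := v) \<in> ?O))"
    by (intro sum.cong refl sum.swap)
  also have "\<dots> = (\<Sum>x\<in>?P A0. \<Sum>v\<in>V. \<Sum>u\<in>V. of_bool (x(a := u) \<in> ?O) * of_bool (x(a := v) \<in> ?O))"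
    by (rule sum.swap)
  also have "\<dots> = (\<Sum>x\<in>?P A0. (r x)\<^sup>2)"
    unfolding r_def power2_eq_square sum_product by (intro sum.cong refl sum.swap)
  finally have cZ: "real (card Z) = (\<Sum>x\<in>?P A0. (r x)\<^sup>2)" .
  have CS: "(real (card ?O))\<^sup>2 \<le> card Z * real ?n ^ card A0"
    unfolding cO cZ using sum_squared_le_sum_of_squares[of r "?P A0"] fin(1) by (simp add: card_PiE)
  \<comment> \<open>Each map in \<open>Z\<close> is an occurrence of the pattern that it induces on
    \<open>insert b A\<close>, and this pattern is a twin pattern.\<close>
  have "Z \<subseteq> (\<Union>H'\<in>twin_patterns A H a b. occurrences V E (insert b A) H')"
  proof
    fix z assume z: "z \<in> Z"
    define H' where "H' = {e \<in> [insert b A]\<^bsup>3\<^esup>. z ` e \<in> E}"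
    have "(e \<in> H' \<longleftrightarrow> e \<in> H) \<and> (id(a := b) ` e \<in> H' \<longleftrightarrow> e \<in> H)" if e: "e \<in> [A]\<^bsup>3\<^esup>" for e
    proof
      have "b \<notin> e" using e assms(5) by (auto simp: nsets_def)
      have "e \<in> [insert b A]\<^bsup>3\<^esup>" using e by (auto simp: nsets_def)
      moreover have "z ` e = z(b := undefined) ` e" using \<open>b \<notin> e\<close> by (intro image_cong) auto
      ultimately show "e \<in> H' \<longleftrightarrow> e \<in> H" using z e by (simp add: H'_def Z_def occurrences_def)
      have "inj_on (id(a := b)) A" using assms(5) by (auto simp: inj_on_def)
      then have "id(a := b) ` e \<in> [insert b A]\<^bsup>3\<^esup>" by (rule nsets_image[OF _ e]) auto
      moreover have "z ` (id(a := b) ` e) = z(a := z b, b := undefined) ` e"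
        unfolding image_image using \<open>b \<notin> e\<close> by (intro image_cong) auto
      ultimately show "id(a := b) ` e \<in> H' \<longleftrightarrow> e \<in> H" using z e by (simp add: H'_def Z_def occurrences_def)
    qed
    then have "H' \<in> twin_patterns A H a b" by (auto simp: twin_patterns_def H'_def)
    moreover have "z \<in> occurrences V E (insert b A) H'" using z by (auto simp: Z_def occurrences_def H'_def)
    ultimately show "z \<in> (\<Union>H'\<in>twin_patterns A H a b. occurrences V E (insert b A) H')" by blast
  qed
  moreover have fT: "finite (twin_patterns A H a b)"
    using assms(3) finite_imp_finite_nsets[of "insert b A" 3] by (simp add: twin_patterns_def)
  ultimately have "card Z \<le> (\<Sum>H'\<in>twin_patterns A H a b. card (occurrences V E (insert b A) H'))"
    using assms by (intro order_trans[OF card_mono card_UN_le]) (auto simp: finite_occurrences)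
  then have Zle: "real (card Z) \<le> (\<Sum>H'\<in>twin_patterns A H a b. real (card (occurrences V E (insert b A) H')))"
    by (metis of_nat_le_iff of_nat_sum)
  have cA: "card A = Suc (card A0)" using A fin by simp
  have "(pattern_density V E A H)\<^sup>2 = (card ?O)\<^sup>2 / (real ?n ^ card A0 * (real ?n ^ card (insert b A)))"
    using assms(3,5) cA by (simp add: pattern_density_def power_divide power2_eq_square mult_ac flip: power_add)
  also have "\<dots> \<le> card Z * real ?n ^ card A0 / (real ?n ^ card A0 * (real ?n ^ card (insert b A)))"
    using CS n by (intro divide_right_mono) auto
  also have "\<dots> = card Z / real ?n ^ card (insert b A)" using n by simp
  also have "\<dots> \<le> (\<Sum>H'\<in>twin_patterns A H a b. pattern_density V E (insert b A) H')"
    unfolding pattern_density_def sum_divide_distrib[symmetric] of_nat_power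
    using Zle n by (intro divide_right_mono) auto
  finally show ?thesis .
qed

subsection \<open>Limit patterns\<close>

lemma ramsey_finite_set:
  fixes qs :: "nat list"
  obtains N where "\<And>(W :: 'i set) f. card W = N \<Longrightarrow> finite W \<Longrightarrow> f ` [W]\<^bsup>r\<^esup> \<subseteq> {..<length qs} \<Longrightarrow>
    \<exists>i<length qs. \<exists>X\<subseteq>W. card X = qs ! i \<and> (\<forall>e\<in>[X]\<^bsup>r\<^esup>. f e = i)"
proof -
  obtain N :: nat where N: "partn_lst {..<N} qs r" using ramsey_full by blast
  have "\<exists>i<length qs. \<exists>X\<subseteq>W. card X = qs ! i \<and> (\<forall>e\<in>[X]\<^bsup>r\<^esup>. f e = i)"
    if W: "card W = N" "finite W" and f: "f ` [W]\<^bsup>r\<^esup> \<subseteq> {..<length qs}" for W :: "'i set" and f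
  proof -
    obtain h where h: "bij_betw h {..<N} W"
      using W ex_bij_betw_nat_finite lessThan_atLeast0 by metis
    then have inj: "inj_on h {..<N}" and hW: "h ` {..<N} = W" by (auto simp: bij_betw_def)
    have "(\<lambda>e. f (h ` e)) \<in> [{..<N}]\<^bsup>r\<^esup> \<rightarrow> {..<length qs}"
      using f nsets_image[OF inj _ eq_refl[OF hW]] by blast
    from partn_lstE[OF N this refl] obtain i X where i: "i < length qs"
      and X: "X \<in> [{..<N}]\<^bsup>(qs ! i)\<^esup>" and fi: "(\<lambda>e. f (h ` e)) ` [X]\<^bsup>r\<^esup> \<subseteq> {i}"
      by metis
    have injX: "inj_on h X" using X inj inj_on_subset by (auto simp: nsets_def)
    have "f e = i" if e: "e \<in> [h ` X]\<^bsup>r\<^esup>" for e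
    proof -
      obtain e' where e': "e' \<subseteq> X" "e = h ` e'"
        using e by (auto simp: nsets_def subset_image_iff)
      then have "e' \<in> [X]\<^bsup>r\<^esup>"
        using e injX X by (auto simp: nsets_def inj_on_subset card_image finite_subset)
      then show ?thesis using fi e' by auto
    qed
    moreover have "h ` X \<subseteq> W" "card (h ` X) = qs ! i"
      using X hW injX by (auto simp: nsets_def card_image)
    ultimately show ?thesis using i by blast
  qed
  then show ?thesis by (rule that)
qed

section \<open>Limit densities and patterns of positive density\<close>

locale convergent_patterns =
  fixes V :: "nat \<Rightarrow> 'a set" and E :: "nat \<Rightarrow> 'a set set"
  assumes finite_V: "finite (V i)" and nonempty_V: "V i \<noteq> {}"
    and conv: "finite (A :: nat set) \<Longrightarrow> convergent (\<lambda>i. pattern_density (V i) (E i) A H)"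
begin

definition limit_density :: "nat set \<Rightarrow> nat set set \<Rightarrow> real" where
  "limit_density A H = lim (\<lambda>i. pattern_density (V i) (E i) A H)"

abbreviation pos :: "nat set \<Rightarrow> nat set set \<Rightarrow> bool" where
  "pos A H \<equiv> 0 < limit_density A H"

lemma limit_density:
  "finite A \<Longrightarrow> (\<lambda>i. pattern_density (V i) (E i) A H) \<longlonglongrightarrow> limit_density A H"
  unfolding limit_density_def using conv convergent_LIMSEQ_iff by blast

lemma limit_density_cong:
  "(\<And>e. e \<in> [A]\<^bsup>3\<^esup> \<Longrightarrow> e \<in> H \<longleftrightarrow> e \<in> H') \<Longrightarrow> limit_density A H = limit_density A H'"
  unfolding limit_density_def pattern_density_def using occurrences_cong by metis

text \<open>The map \<open>g\<close> covers both passing to a subpattern and renaming vertices; the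
  inequality between the densities survives in the limit.\<close>

lemma pos_pullback:
  assumes "pos A H" "finite A" "inj_on g B" "g ` B \<subseteq> A" "\<And>e. e \<in> [B]\<^bsup>3\<^esup> \<Longrightarrow> g ` e \<in> H \<longleftrightarrow> e \<in> H'"
  shows "pos B H'"
proof -
  have fB: "finite B" using assms finite_subset inj_on_finite by blast
  have "limit_density A H \<le> limit_density B {e. g ` e \<in> H}"
    using pattern_density_pullback[OF finite_V nonempty_V assms(2-4)]
    by (intro LIMSEQ_le[OF limit_density[OF assms(2)] limit_density[OF fB]]) blast
  also have "\<dots> = limit_density B H'" using assms(5) by (intro limit_density_cong) auto
  finally show ?thesis using assms(1) by simp
qed

text \<open>Each map from \<open>A\<close> to \<open>V i\<close> is an occurrence of the pattern it
  induces, so the densities of the finitely many patterns add up to at least \<open>1\<close>, also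
  in the limit.\<close>

lemma ex_pos:
  assumes "finite A"
  shows "\<exists>H. pos A H"
proof -
  have "1 \<le> (\<Sum>H\<in>Pow ([A]\<^bsup>3\<^esup>). pattern_density (V i) (E i) A H)" for i
  proof -
    have n: "0 < card (V i)" using finite_V nonempty_V by (simp add: card_gt_0_iff)
    have fP: "finite (Pow ([A]\<^bsup>3\<^esup>))" using finite_imp_finite_nsets[OF assms] by simp
    have "PiE A (\<lambda>_. V i) \<subseteq> (\<Union>H\<in>Pow ([A]\<^bsup>3\<^esup>). occurrences (V i) (E i) A H)"
    proof
      fix x assume "x \<in> PiE A (\<lambda>_. V i)"
      then have "x \<in> occurrences (V i) (E i) A {e \<in> [A]\<^bsup>3\<^esup>. x ` e \<in> E i}"
        by (simp add: occurrences_def)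
      then show "x \<in> (\<Union>H\<in>Pow ([A]\<^bsup>3\<^esup>). occurrences (V i) (E i) A H)"
        by (rule UN_I[rotated]) simp
    qed
    then have "card (PiE A (\<lambda>_. V i)) \<le> card (\<Union>H\<in>Pow ([A]\<^bsup>3\<^esup>). occurrences (V i) (E i) A H)"
      using fP finite_occurrences[OF finite_V assms] by (intro card_mono finite_UN_I) simp_all
    also have "\<dots> \<le> (\<Sum>H\<in>Pow ([A]\<^bsup>3\<^esup>). card (occurrences (V i) (E i) A H))"
      by (rule card_UN_le[OF fP])
    finally have "card (PiE A (\<lambda>_. V i)) \<le> \<dots>" .
    then have "real (card (V i)) ^ card A \<le> (\<Sum>H\<in>Pow ([A]\<^bsup>3\<^esup>). real (card (occurrences (V i) (E i) A H)))"
      using assms by (simp add: card_PiE) (metis of_nat_le_iff of_nat_power of_nat_sum)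
    then show ?thesis using n by (simp add: pattern_density_def flip: sum_divide_distrib)
  qed
  moreover have "(\<lambda>i. \<Sum>H\<in>Pow ([A]\<^bsup>3\<^esup>). pattern_density (V i) (E i) A H)
      \<longlonglongrightarrow> (\<Sum>H\<in>Pow ([A]\<^bsup>3\<^esup>). limit_density A H)"
    by (intro tendsto_sum limit_density assms)
  ultimately have "1 \<le> (\<Sum>H\<in>Pow ([A]\<^bsup>3\<^esup>). limit_density A H)"
    by (intro LIMSEQ_le_const) auto
  then have "\<not> (\<forall>H\<in>Pow ([A]\<^bsup>3\<^esup>). limit_density A H \<le> 0)"
    by (meson not_one_le_zero order_trans sum_nonpos)
  then show ?thesis using not_le by blast
qed

lemma pos_twin:
  assumes "pos A H" "finite A" "a \<in> A" "b \<notin> A"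
  obtains H' where "pos (insert b A) H'" "\<And>e. e \<in> [A]\<^bsup>3\<^esup> \<Longrightarrow> e \<in> H' \<longleftrightarrow> e \<in> H"
    "\<And>e. e \<in> [A]\<^bsup>3\<^esup> \<Longrightarrow> id(a := b) ` e \<in> H' \<longleftrightarrow> e \<in> H"
proof -
  have "(limit_density A H)\<^sup>2 \<le> (\<Sum>H'\<in>twin_patterns A H a b. limit_density (insert b A) H')"
    using pattern_density_twin[OF finite_V nonempty_V assms(2-4)] assms(2)
    by (intro LIMSEQ_le[OF tendsto_power[OF limit_density] tendsto_sum[OF limit_density]]) auto
  then have "0 < (\<Sum>H'\<in>twin_patterns A H a b. limit_density (insert b A) H')"
    using assms(1) by (smt (verit) zero_less_power2)
  then have "\<not> (\<forall>H'\<in>twin_patterns A H a b. limit_density (insert b A) H' \<le> 0)"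
    by (meson not_le sum_nonpos)
  then show ?thesis using that by (auto simp: twin_patterns_def not_le)
qed

text \<open>The vertices of the blow-up are \<open>A\<close> and the copies \<open>M + b\<close> for \<open>b \<in> B\<close>.\<close>

lemma pos_blowup:
  assumes "pos A H" "A \<subseteq> {..<M}" "B \<subseteq> A"
  shows "\<exists>H'. pos (A \<union> (+) M ` B) H' \<and>
    (\<forall>C\<subseteq>B. \<forall>e\<in>[A]\<^bsup>3\<^esup>. (\<lambda>a. if a \<in> C then M + a else a) ` e \<in> H' \<longleftrightarrow> e \<in> H)"
proof -
  have fA: "finite A" using assms(2) finite_subset by blast
  define \<gamma> where "\<gamma> C = (\<lambda>a. if a \<in> C then M + a else a)" for C
  have inj\<gamma>: "inj_on (\<gamma> C) A" for C
  proof (rule inj_onI)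
    fix x y assume "x \<in> A" "y \<in> A" "\<gamma> C x = \<gamma> C y"
    moreover have "x < M" "y < M" using \<open>x \<in> A\<close> \<open>y \<in> A\<close> assms(2) by auto
    ultimately show "x = y" by (auto simp: \<gamma>_def split: if_splits)
  qed
  have "finite B" using fA assms(3) finite_subset by blast
  then have "\<exists>H'. pos (A \<union> (+) M ` B) H' \<and> (\<forall>C\<subseteq>B. \<forall>e\<in>[A]\<^bsup>3\<^esup>. \<gamma> C ` e \<in> H' \<longleftrightarrow> e \<in> H)"
    using assms(3)
  proof (induction B rule: finite_induct)
    case empty
    then show ?case using assms(1) by (intro exI[of _ H]) (auto simp: \<gamma>_def)
  next
    case (insert b B)
    let ?A = "A \<union> (+) M ` B"
    obtain H' where H': "pos ?A H'" "\<And>C e. C \<subseteq> B \<Longrightarrow> e \<in> [A]\<^bsup>3\<^esup> \<Longrightarrow> \<gamma> C ` e \<in> H' \<longleftrightarrow> e \<in> H"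
      using insert by auto
    have b: "b \<in> ?A" "M + b \<notin> ?A" using insert.hyps insert.prems assms(2) by auto
    have fin: "finite ?A" using fA insert.hyps by simp
    obtain H'' where H'': "pos (insert (M + b) ?A) H''"
      "\<And>e. e \<in> [?A]\<^bsup>3\<^esup> \<Longrightarrow> e \<in> H'' \<longleftrightarrow> e \<in> H'"
      "\<And>e. e \<in> [?A]\<^bsup>3\<^esup> \<Longrightarrow> id(b := M + b) ` e \<in> H'' \<longleftrightarrow> e \<in> H'"
      using pos_twin[OF H'(1) fin b] by metis
    have "\<gamma> C ` e \<in> H'' \<longleftrightarrow> e \<in> H" if C: "C \<subseteq> insert b B" and e: "e \<in> [A]\<^bsup>3\<^esup>" for C e
    proof -
      \<comment> \<open>A copy that uses \<open>M + b\<close> arises from the copy for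
        \<open>C - {b}\<close> by exchanging \<open>b\<close> for its twin; every other copy already
        lies in \<open>?A\<close>, where \<open>H''\<close> agrees with \<open>H'\<close>.\<close>
      have CB: "C - {b} \<subseteq> B" using C by blast
      have mem: "\<gamma> (C - {b}) ` e \<in> [?A]\<^bsup>3\<^esup>"
        using CB by (intro nsets_image[OF inj\<gamma> e]) (auto simp: \<gamma>_def)
      have "\<gamma> (C - {b}) ` e \<in> H' \<longleftrightarrow> e \<in> H" using H'(2)[OF CB e] .
      show ?thesis
      proof (cases "b \<in> C")
        case True
        have "\<gamma> C x = (id(b := M + b)) (\<gamma> (C - {b}) x)" if "x \<in> e" for x
        proof -
          have "b < M" using insert.prems assms(2) by auto
          then show ?thesis using True by (cases "x = b") (simp_all add: \<gamma>_def)
        qed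
        then have "\<gamma> C ` e = id(b := M + b) ` \<gamma> (C - {b}) ` e"
          unfolding image_image by (intro image_cong) auto
        then show ?thesis using H''(3)[OF mem] H'(2)[OF CB e] by simp
      next
        case False
        then have "C - {b} = C" by blast
        then show ?thesis using H''(2)[OF mem] H'(2)[OF CB e] by simp
      qed
    qed
    then show ?case using H''(1) by (intro exI[of _ H'']) auto
  qed
  then show ?thesis unfolding \<gamma>_def .
qed

section \<open>Locked triples and the dichotomy\<close>

definition locked :: "nat set \<Rightarrow> nat set set \<Rightarrow> nat set \<Rightarrow> bool" where
  "locked A H e \<longleftrightarrow> \<not> pos A (sym_diff H {e})"

text \<open>Locking persists in extensions, so in a pattern with the maximal number of locked triples
  an unlocked triple remains unlocked in every extension.\<close>

lemma ex_maximally_locked: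
  obtains A W H where "finite A" "W \<subseteq> A" "card W = N" "pos A H"
    "\<And>e B H' g. \<lbrakk>e \<in> [W]\<^bsup>3\<^esup>; \<not> locked A H e; finite B; pos B H'; inj_on g A; g ` A \<subseteq> B;
       \<And>f. f \<in> [A]\<^bsup>3\<^esup> \<Longrightarrow> g ` f \<in> H' \<longleftrightarrow> f \<in> H\<rbrakk> \<Longrightarrow> pos B (sym_diff H' {g ` e})"
proof -
  define P where "P = (\<lambda>(A, H, W). finite A \<and> W \<subseteq> A \<and> card W = N \<and> pos A H)"
  define L where "L = (\<lambda>(A, H, W). {e \<in> [W]\<^bsup>3\<^esup>. locked A H e})"
  obtain H0 where "pos {..<N} H0" using ex_pos by blast
  then have "P ({..<N}, H0, {..<N})" by (simp add: P_def)
  \<comment> \<open>The number of locked triples is bounded in terms of \<open>N\<close> alone,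
    however large \<open>A\<close> may be; hence the maximum is attained.\<close>
  moreover have Lb: "card (L s) \<le> N choose 3" if "P s" for s
  proof -
    obtain A H W where s: "s = (A, H, W)" by (cases s)
    have "finite ([W]\<^bsup>3\<^esup>)" using that s finite_subset by (auto simp: P_def intro: finite_imp_finite_nsets)
    moreover have "L s \<subseteq> [W]\<^bsup>3\<^esup>" by (auto simp: L_def s)
    ultimately have "card (L s) \<le> card ([W]\<^bsup>3\<^esup>)" by (rule card_mono)
    moreover have "card W = N" using that by (simp add: s P_def)
    ultimately show ?thesis by simp
  qed
  ultimately have "\<exists>s. P s \<and> (\<forall>s'. P s' \<longrightarrow> card (L s') \<le> card (L s))"
    by (intro ex_has_greatest_nat[of P _ "\<lambda>s. card (L s)" "Suc (N choose 3)"]) (auto simp: less_Suc_eq_le)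
  then obtain s where s: "P s" "\<And>s'. P s' \<Longrightarrow> card (L s') \<le> card (L s)" by blast
  obtain A H W where [simp]: "s = (A, H, W)" by (cases s)
  have A: "finite A" "W \<subseteq> A" "card W = N" "pos A H" using s(1) by (auto simp: P_def)
  have "pos B (sym_diff H' {g ` e})"
    if e: "e \<in> [W]\<^bsup>3\<^esup>" "\<not> locked A H e" and B: "finite B" "pos B H'" "inj_on g A" "g ` A \<subseteq> B"
      and gH: "\<And>f. f \<in> [A]\<^bsup>3\<^esup> \<Longrightarrow> g ` f \<in> H' \<longleftrightarrow> f \<in> H" for e B H' g
  proof (rule ccontr)
    \<comment> \<open>Otherwise the image of \<open>e\<close> would be locked in
      \<open>(B, H')\<close>, together with the images of all triples locked before, so
      \<open>?s\<close> would have more locked triples than \<open>s\<close>.\<close>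
    assume np: "\<not> pos B (sym_diff H' {g ` e})"
    let ?s = "(B, H', g ` W)"
    have injW: "inj_on g W" using B(3) A(2) inj_on_subset by blast
    have Ps: "P ?s" using A B injW by (auto simp: P_def card_image)
    have img: "g ` f = g ` f' \<longleftrightarrow> f = f'" if "f \<in> [A]\<^bsup>3\<^esup>" "f' \<in> [A]\<^bsup>3\<^esup>" for f f'
      using that B(3) by (intro inj_on_image_eq_iff[of g A]) (auto simp: nsets_def)
    have WA: "[W]\<^bsup>3\<^esup> \<subseteq> [A]\<^bsup>3\<^esup>" using A(2) by (rule nsets_mono)
    have "locked B H' (g ` f)" if f: "f \<in> [W]\<^bsup>3\<^esup>" "locked A H f" for f
      unfolding locked_def
    proof
      assume "pos B (sym_diff H' {g ` f})"
      moreover have "g ` f' \<in> sym_diff H' {g ` f} \<longleftrightarrow> f' \<in> sym_diff H {f}" if "f' \<in> [A]\<^bsup>3\<^esup>" for f'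
        using img[OF that subsetD[OF WA f(1)]] gH[OF that] by auto
      ultimately have "pos A (sym_diff H {f})" by (rule pos_pullback[OF _ B(1,3,4)])
      then show False using f(2) by (simp add: locked_def)
    qed
    then have sub: "insert (g ` e) ((`) g ` L s) \<subseteq> L ?s"
      using np e(1) by (auto simp: L_def locked_def intro!: nsets_image[OF injW])
    have LA: "L s \<subseteq> [A]\<^bsup>3\<^esup>" using WA by (auto simp: L_def)
    have "e \<notin> L s" using e(2) by (simp add: L_def)
    then have "g ` e \<notin> (`) g ` L s" using img LA e(1) WA by blast
    moreover have "inj_on ((`) g) (L s)" using img LA by (intro inj_onI) blast
    moreover have fin: "finite ([A]\<^bsup>3\<^esup>)" "finite ([g ` W]\<^bsup>3\<^esup>)"
      using A finite_subset by (blast intro: finite_imp_finite_nsets)+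
    then have "finite (L s)" "finite (L ?s)"
      using LA finite_subset by (auto simp: L_def)
    ultimately have "Suc (card (L s)) \<le> card (L ?s)"
      using card_mono[OF _ sub] by (simp add: card_image)
    then show False using s(2)[OF Ps] by simp
  qed
  with A show ?thesis by (rule that)
qed

text \<open>Ramsey's theorem with three colours: unlocked, locked edge, locked non-edge. Here
  \<open>Y\<close> is a copy of the vertex set of a maximally locked pattern, placed so that every
  triple \<open>e\<close> lies in a copy of the pattern inside \<open>e \<union> Y\<close>. So flips
  of unlocked triples can be combined, and a locked \<open>e\<close> is locked by
  \<open>e \<union> Y\<close> without the other vertices of \<open>S\<close>.\<close>

lemma all_patterns_or_locked:
  "(\<exists>K. finite K \<and> card K = k \<and> (\<forall>H. pos K H)) \<or>
   (\<exists>S Y H p. finite S \<and> finite Y \<and> S \<inter> Y = {} \<and> card S = m \<and> pos (S \<union> Y) H \<and>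
      (\<forall>e\<in>[S]\<^bsup>3\<^esup>. (e \<in> H \<longleftrightarrow> p) \<and> locked (e \<union> Y) H e))"
proof -
  obtain N where N: "\<And>(W :: nat set) f. card W = N \<Longrightarrow> finite W \<Longrightarrow> f ` [W]\<^bsup>3\<^esup> \<subseteq> {..<length [k, m, m]} \<Longrightarrow>
    \<exists>i<length [k, m, m]. \<exists>X\<subseteq>W. card X = [k, m, m] ! i \<and> (\<forall>e\<in>[X]\<^bsup>3\<^esup>. f e = i)"
    using ramsey_finite_set[of 3 "[k, m, m]"] by metis
  obtain A W H where A: "finite A" "W \<subseteq> A" "card W = N" "pos A H" and
    free: "\<And>e B H' g. \<lbrakk>e \<in> [W]\<^bsup>3\<^esup>; \<not> locked A H e; finite B; pos B H'; inj_on g A; g ` A \<subseteq> B;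
       \<And>f. f \<in> [A]\<^bsup>3\<^esup> \<Longrightarrow> g ` f \<in> H' \<longleftrightarrow> f \<in> H\<rbrakk> \<Longrightarrow> pos B (sym_diff H' {g ` e})"
    using ex_maximally_locked[of N] by metis
  obtain M where M: "A \<subseteq> {..<M}" using A(1) finite_nat_iff_bounded by blast
  define Y where "Y = (+) M ` A"
  have fin: "finite Y" "finite (A \<union> Y)" and disj: "A \<inter> Y = {}" using A(1) M by (auto simp: Y_def)
  \<comment> \<open>\<open>\<gamma> e\<close> embeds the pattern into its blow-up; \<open>e\<close> is the only triple of \<open>A\<close> in the image.\<close>
  define \<gamma> where "\<gamma> e = (\<lambda>a. if a \<in> A - e then M + a else a)" for e
  obtain H2 where H2: "pos (A \<union> Y) H2"
    and bl: "\<forall>C\<subseteq>A. \<forall>e\<in>[A]\<^bsup>3\<^esup>. (\<lambda>a. if a \<in> C then M + a else a) ` e \<in> H2 \<longleftrightarrow> e \<in> H"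
    using pos_blowup[OF A(4) M subset_refl] unfolding Y_def by metis
  have \<gamma>H: "\<gamma> e ` f \<in> H2 \<longleftrightarrow> f \<in> H" if "f \<in> [A]\<^bsup>3\<^esup>" for e f
    unfolding \<gamma>_def using bl that by blast
  have eH: "f \<in> H2 \<longleftrightarrow> f \<in> H" if "f \<in> [A]\<^bsup>3\<^esup>" for f
    using bl[rule_format, of "{}" f] that by simp
  have \<gamma>inj: "inj_on (\<gamma> e) A" for e
  proof (rule inj_onI)
    fix x y assume "x \<in> A" "y \<in> A" "\<gamma> e x = \<gamma> e y"
    moreover have "x < M" "y < M" using \<open>x \<in> A\<close> \<open>y \<in> A\<close> M by auto
    ultimately show "x = y" by (auto simp: \<gamma>_def split: if_splits)
  qed
  have \<gamma>e: "\<gamma> e ` e = e" if "e \<subseteq> A" for e using that by (auto simp: \<gamma>_def image_iff)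
  have \<gamma>im: "\<gamma> e ` A \<subseteq> e \<union> Y" for e by (auto simp: \<gamma>_def Y_def)
  have \<gamma>sub: "f = e" if "\<gamma> e ` f \<subseteq> A" "f \<in> [A]\<^bsup>3\<^esup>" "e \<in> [A]\<^bsup>3\<^esup>" for e f
  proof -
    have "f \<subseteq> e" using that(1,2) M by (auto simp: \<gamma>_def nsets_def split: if_splits)
    then show ?thesis using that(2,3) card_subset_eq[of e f] by (auto simp: nsets_def)
  qed
  have WA: "[W]\<^bsup>3\<^esup> \<subseteq> [A]\<^bsup>3\<^esup>" using A(2) by (rule nsets_mono)
  define col where "col e = (if \<not> locked A H e then 0 else if e \<in> H then 1 else 2 :: nat)" for e
  have fW: "finite W" using A finite_subset by blast
  obtain i X where i: "i < 3" and X: "X \<subseteq> W" "card X = [k, m, m] ! i" "\<forall>e\<in>[X]\<^bsup>3\<^esup>. col e = i"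
  proof -
    have "col ` [W]\<^bsup>3\<^esup> \<subseteq> {..<length [k, m, m]}" by (auto simp: col_def)
    from N[OF A(3) fW this] that show ?thesis by (metis length_Cons list.size(3) numeral_3_eq_3)
  qed
  have XW: "[X]\<^bsup>3\<^esup> \<subseteq> [W]\<^bsup>3\<^esup>" using X(1) by (rule nsets_mono)
  show ?thesis
  proof (cases "i = 0")
    case True
    \<comment> \<open>The triples are flipped one at a time. The image under
      \<open>\<gamma> e\<close> contains no triple flipped before, as its only triple within
      \<open>A\<close> is \<open>e\<close>; so it still carries \<open>H\<close>, and
      \<open>free\<close> applies.\<close>
    have flip: "pos (A \<union> Y) (sym_diff H2 Q)" if "finite Q" "Q \<subseteq> [X]\<^bsup>3\<^esup>" for Q
      using that
    proof (induction Q rule: finite_induct)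
      case empty
      then show ?case using H2 by simp
    next
      case (insert e Q)
      have e: "e \<in> [W]\<^bsup>3\<^esup>" "e \<in> [A]\<^bsup>3\<^esup>" "\<not> locked A H e"
        using insert.prems XW WA X(3) True by (auto simp: col_def split: if_splits)
      have "\<gamma> e ` f \<in> sym_diff H2 Q \<longleftrightarrow> f \<in> H" if f: "f \<in> [A]\<^bsup>3\<^esup>" for f
      proof -
        have "\<gamma> e ` f \<notin> Q"
        proof
          assume q: "\<gamma> e ` f \<in> Q"
          then have "\<gamma> e ` f \<in> [A]\<^bsup>3\<^esup>" using insert.prems XW WA by blast
          then have "\<gamma> e ` f \<subseteq> A" by (simp add: nsets_def)
          then have "f = e" using f e(2) by (rule \<gamma>sub)
          then show False using \<gamma>e[of e] e(2) q insert.hyps by (simp add: nsets_def)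
        qed
        then show ?thesis using \<gamma>H[OF f] by simp
      qed
      then have "pos (A \<union> Y) (sym_diff (sym_diff H2 Q) {\<gamma> e ` e})"
        using insert \<gamma>im[of e] e(2) by (intro free[OF e(1,3) fin(2) _ \<gamma>inj]) (auto simp: nsets_def)
      moreover have "sym_diff (sym_diff H2 Q) {\<gamma> e ` e} = sym_diff H2 (insert e Q)"
        using insert.hyps \<gamma>e[of e] e(2) by (auto simp: nsets_def)
      ultimately show ?case by simp
    qed
    \<comment> \<open>Flipping exactly the triples on which \<open>H2\<close> and \<open>H'\<close>
      differ turns the pattern on \<open>X\<close> into \<open>H'\<close>.\<close>
    have "pos X H'" for H'
    proof (rule pos_pullback[where g = id])
      show "pos (A \<union> Y) (sym_diff H2 {e \<in> [X]\<^bsup>3\<^esup>. (e \<in> H2) \<noteq> (e \<in> H')})"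
        using finite_imp_finite_nsets[OF finite_subset[OF X(1) fW], of 3] by (intro flip) auto
    qed (use fin X(1) A(2) in auto)
    moreover have "finite X" using finite_subset[OF X(1) fW] .
    moreover have "card X = k" using X(2) True by simp
    ultimately show ?thesis by blast
  next
    case False
    have "(e \<in> H2 \<longleftrightarrow> i = 1) \<and> locked (e \<union> Y) H2 e" if eX: "e \<in> [X]\<^bsup>3\<^esup>" for e
    proof
      have e: "e \<in> [A]\<^bsup>3\<^esup>" "locked A H e" and iH: "e \<in> H \<longleftrightarrow> i = 1"
        using eX XW WA X(3) False by (auto simp: col_def split: if_splits)
      show "e \<in> H2 \<longleftrightarrow> i = 1" using eH[OF e(1)] iH by simp
      show "locked (e \<union> Y) H2 e" unfolding locked_def
      proof
        \<comment> \<open>If the flip had positive density on \<open>e \<union> Y\<close>, then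
          pulling back along \<open>\<gamma> e\<close>, which fixes \<open>e\<close>, would unlock
          \<open>e\<close> in \<open>A\<close>.\<close>
        assume "pos (e \<union> Y) (sym_diff H2 {e})"
        moreover have "\<gamma> e ` f \<in> sym_diff H2 {e} \<longleftrightarrow> f \<in> sym_diff H {e}" if f: "f \<in> [A]\<^bsup>3\<^esup>" for f
        proof -
          have "\<gamma> e ` e = e" using \<gamma>e e(1) by (auto simp: nsets_def)
          then have "\<gamma> e ` f = e \<longleftrightarrow> f = e"
            using inj_on_image_eq_iff[OF \<gamma>inj, of f e e] f e(1) by (auto simp: nsets_def)
          then show ?thesis using \<gamma>H[OF f] by auto
        qed
        moreover have "finite (e \<union> Y)" using fin(1) e(1) by (simp add: nsets_def)
        ultimately have "pos A (sym_diff H {e})"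
          using pos_pullback[of "e \<union> Y" "sym_diff H2 {e}" "\<gamma> e" A "sym_diff H {e}", OF _ _ \<gamma>inj \<gamma>im]
          by metis
        then show False using e(2) by (simp add: locked_def)
      qed
    qed
    moreover have "pos (X \<union> Y) H2"
      by (rule pos_pullback[OF H2 fin(2), of id]) (use X(1) A(2) in auto)
    moreover have "card X = m" using X(2) i False by (auto simp: less_Suc_eq numeral_3_eq_3 nth_Cons')
    moreover have "finite X" using finite_subset[OF X(1) fW] .
    moreover have "X \<inter> Y = {}" using X(1) A(2) disj by blast
    ultimately have "finite X \<and> finite Y \<and> X \<inter> Y = {} \<and> card X = m \<and> pos (X \<union> Y) H2 \<and>
        (\<forall>e\<in>[X]\<^bsup>3\<^esup>. (e \<in> H2 \<longleftrightarrow> i = 1) \<and> locked (e \<union> Y) H2 e)"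
      using fin(1) by simp
    then show ?thesis
      by (intro disjI2, rule_tac exI[of _ X], rule_tac exI[of _ Y], rule_tac exI[of _ H2],
          rule_tac exI[of _ "i = 1"])
  qed
qed

end

subsection \<open>From locked patterns to homogeneous sets\<close>

text \<open>Some assignment of the coordinates in \<open>Y\<close> attains at least the mean over
  all assignments; it is chosen one coordinate at a time.\<close>

lemma ex_fixed_coordinates:
  fixes G :: "('i \<Rightarrow> 'a) \<Rightarrow> real"
  assumes "finite Y" "S \<inter> Y = {}" "finite S" "finite V" "V \<noteq> {}"
    and "d * real (card V) ^ card (S \<union> Y) \<le> (\<Sum>z\<in>PiE (S \<union> Y) (\<lambda>_. V). G z)"
  shows "\<exists>y\<in>PiE Y (\<lambda>_. V). d * real (card V) ^ card S \<le>
    (\<Sum>x\<in>PiE S (\<lambda>_. V). G (\<lambda>a. if a \<in> Y then y a else x a))"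
  using assms(1,2,6)
proof (induction Y arbitrary: G rule: finite_induct)
  case empty
  then show ?case by simp
next
  case (insert b Y)
  let ?n = "real (card V)"
  have b: "b \<notin> S \<union> Y" using insert by auto
  have fin: "finite (S \<union> Y)" using insert assms(3) by simp
  have "(\<Sum>v\<in>V. d * ?n ^ card (S \<union> Y)) = d * ?n ^ card (S \<union> insert b Y)"
    using b fin by simp
  also have "\<dots> \<le> (\<Sum>v\<in>V. \<Sum>z\<in>PiE (S \<union> Y) (\<lambda>_. V). G (z(b := v)))"
    using insert.prems(2) by (simp add: sum_PiE_insert[OF b])
  finally obtain v where v: "v \<in> V" "d * ?n ^ card (S \<union> Y) \<le> (\<Sum>z\<in>PiE (S \<union> Y) (\<lambda>_. V). G (z(b := v)))"
    using assms(4,5) by (meson not_le sum_strict_mono)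
  then obtain y where y: "y \<in> PiE Y (\<lambda>_. V)" "d * ?n ^ card S \<le>
      (\<Sum>x\<in>PiE S (\<lambda>_. V). G ((\<lambda>a. if a \<in> Y then y a else x a)(b := v)))"
    using insert.IH[of "\<lambda>z. G (z(b := v))"] insert.prems(1) by auto
  have "(\<lambda>a. if a \<in> Y then y a else x a)(b := v) =
      (\<lambda>a. if a \<in> insert b Y then (y(b := v)) a else x a)" for x :: "'i \<Rightarrow> 'a"
    by auto
  then have "d * ?n ^ card S \<le>
      (\<Sum>x\<in>PiE S (\<lambda>_. V). G (\<lambda>a. if a \<in> insert b Y then (y(b := v)) a else x a))"
    using y(2) by simp
  moreover have "y(b := v) \<in> PiE (insert b Y) (\<lambda>_. V)" using y(1) v(1) by (intro PiE_upd)
  ultimately show ?case by blast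
qed

text \<open>A union bound over the pairs \<open>(a, b)\<close>: a collision \<open>z a = z b\<close>
  with \<open>a \<noteq> b\<close> determines \<open>z a\<close> from the other values, so it occurs
  for at most one in \<open>card V\<close> of the maps.\<close>

lemma card_not_inj_on_le:
  assumes "finite A" "S \<subseteq> A" "finite V"
  shows "card {z \<in> PiE A (\<lambda>_. V). \<not> inj_on z S} * card V \<le> (card S)\<^sup>2 * card V ^ card A"
proof -
  have fS: "finite S" using assms finite_subset by blast
  let ?B = "\<lambda>(a, b). {z \<in> PiE A (\<lambda>_. V). a \<noteq> b \<and> z a = z b}"
  have fB: "finite (?B q)" for q using assms by (cases q) (simp add: finite_PiE)
  have B: "card (?B q) * card V \<le> card V ^ card A" if "q \<in> S \<times> S" for q
  proof -
    obtain a b where q: "q = (a, b)" by (cases q)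
    show ?thesis
    proof (cases "a = b")
      case False
      have ab: "a \<in> A" "b \<in> A - {a}" using that q assms(2) False by auto
      have "card (?B q) \<le> card (PiE (A - {a}) (\<lambda>_. V))"
      proof (rule card_inj_on_le)
        show "inj_on (\<lambda>z. restrict z (A - {a})) (?B q)"
        proof (rule inj_onI)
          fix x y assume x: "x \<in> ?B q" and y: "y \<in> ?B q"
            and eq: "restrict x (A - {a}) = restrict y (A - {a})"
          have *: "x c = y c" if "c \<in> A - {a}" for c using fun_cong[OF eq, of c] that by simp
          have "x c = y c" if "c \<in> A" for c
            using *[of c] *[OF ab(2)] that x y q by (cases "c = a") auto
          then show "x = y" using x y q by (intro PiE_ext[of x A _ y]) auto
        qed
        show "(\<lambda>z. restrict z (A - {a})) ` ?B q \<subseteq> PiE (A - {a}) (\<lambda>_. V)"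
          using q by (auto simp: PiE_iff extensional_def split: if_splits)
        show "finite (PiE (A - {a}) (\<lambda>_. V))" using assms by (simp add: finite_PiE)
      qed
      then have "card (?B q) * card V \<le> card V ^ card (A - {a}) * card V"
        using assms(1) by (simp add: card_PiE)
      also have "\<dots> = card V ^ card A"
        using ab(1) assms(1) by (metis card.remove power_Suc mult.commute)
      finally show ?thesis .
    qed (simp add: q)
  qed
  have "{z \<in> PiE A (\<lambda>_. V). \<not> inj_on z S} \<subseteq> (\<Union>q\<in>S\<times>S. ?B q)"
    by (auto simp: inj_on_def)
  then have "card {z \<in> PiE A (\<lambda>_. V). \<not> inj_on z S} \<le> card (\<Union>q\<in>S\<times>S. ?B q)"
    using fS fB by (intro card_mono finite_UN_I) simp_all
  also have "\<dots> \<le> (\<Sum>q\<in>S\<times>S. card (?B q))"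
    using fS by (intro card_UN_le) simp
  finally have "card {z \<in> PiE A (\<lambda>_. V). \<not> inj_on z S} * card V \<le> (\<Sum>q\<in>S\<times>S. card (?B q)) * card V"
    by (rule mult_le_mono1)
  also have "\<dots> = (\<Sum>q\<in>S\<times>S. card (?B q) * card V)" by (rule sum_distrib_right)
  also have "\<dots> \<le> (\<Sum>q\<in>S\<times>S. card V ^ card A)" by (intro sum_mono B)
  finally show ?thesis by (simp add: card_cartesian_product power2_eq_square)
qed

text \<open>A triple of \<open>e \<union> Y\<close> other than \<open>e\<close> misses some vertex
  of \<open>e\<close>, so it lies in \<open>{a, b} \<union> Y\<close> for the other two vertices and
  is controlled by a pair condition. The pair conditions with the wrong colour at \<open>e\<close>
  thus give an occurrence of the flipped pattern, which is rare if \<open>e\<close> is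
  locked.\<close>

lemma occurrences_sym_diff:
  assumes "e \<in> [S]\<^bsup>3\<^esup>" "S \<inter> Y = {}" "z \<in> PiE (S \<union> Y) (\<lambda>_. V)" "(z ` e \<in> E) \<noteq> (e \<in> H)"
    and pairs: "\<And>a b. a \<in> S \<Longrightarrow> b \<in> S \<Longrightarrow> a \<noteq> b \<Longrightarrow>
      restrict z ({a, b} \<union> Y) \<in> occurrences V E ({a, b} \<union> Y) H"
  shows "restrict z (e \<union> Y) \<in> occurrences V E (e \<union> Y) (sym_diff H {e})"
proof -
  have e: "e \<subseteq> S" "finite e" "card e = 3" using assms(1) by (auto simp: nsets_def)
  have "restrict z (e \<union> Y) ` f \<in> E \<longleftrightarrow> f \<in> sym_diff H {e}" if f: "f \<in> [e \<union> Y]\<^bsup>3\<^esup>" for f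
  proof -
    have zf: "restrict z (e \<union> Y) ` f = z ` f"
      using f by (intro image_cong) (auto simp: nsets_def)
    show ?thesis
    proof (cases "f = e")
      case True
      then show ?thesis using assms(4) zf by auto
    next
      case False
      have "\<not> e \<subseteq> f" using False f e card_subset_eq[of f e] by (auto simp: nsets_def)
      then obtain c where c: "c \<in> e" "c \<notin> f" by blast
      then have "card (e - {c}) = 2" using e by simp
      then obtain a b where ab: "e - {c} = {a, b}" "a \<noteq> b" by (auto simp: card_2_iff)
      then have "a \<in> S" "b \<in> S" using e(1) by auto
      have "f \<subseteq> {a, b} \<union> Y" using f c ab by (auto simp: nsets_def)
      then have f': "f \<in> [{a, b} \<union> Y]\<^bsup>3\<^esup>" using f by (auto simp: nsets_def)
      have "restrict z ({a, b} \<union> Y) ` f = z ` f"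
        using \<open>f \<subseteq> {a, b} \<union> Y\<close> by (intro image_cong) auto
      moreover have "restrict z ({a, b} \<union> Y) ` f \<in> E \<longleftrightarrow> f \<in> H"
        using pairs[OF \<open>a \<in> S\<close> \<open>b \<in> S\<close> ab(2)] f' unfolding occurrences_def by blast
      ultimately have "z ` f \<in> E \<longleftrightarrow> f \<in> H" by simp
      then show ?thesis using False zf by simp
    qed
  qed
  moreover have "restrict z (e \<union> Y) \<in> PiE (e \<union> Y) (\<lambda>_. V)"
    using assms(3) e(1) by (auto simp: PiE_iff)
  ultimately show ?thesis by (simp add: occurrences_def)
qed

section \<open>Parts of logarithmic size with few wrong transversal triples\<close>

lemma card_occurrences: "finite V \<Longrightarrow> V \<noteq> {} \<Longrightarrow>
  real (card (occurrences V E A H)) = pattern_density V E A H * real (card V) ^ card A"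
  by (simp add: pattern_density_def)

text \<open>Of the density \<open>d\<close>, one quarter may be lost to non-injective maps and one
  quarter to wrong triples in cliques; the remaining \<open>d / 2\<close> is fed into
  \<open>log_blowup\<close>. The bound on the sum of the flipped densities is what locking
  provides.\<close>

lemma ex_log_parts:
  fixes S Y :: "'i set" and d :: real and p :: bool
  assumes "finite S" "finite Y" "S \<inter> Y = {}" "d > 0" "\<forall>e\<in>[S]\<^bsup>3\<^esup>. e \<in> H \<longleftrightarrow> p"
  shows "\<exists>c>0. \<forall>(V :: 'a set) E t. finite V \<longrightarrow> V \<noteq> {} \<longrightarrow>
     d \<le> pattern_density V E (S \<union> Y) H \<longrightarrow>
     (\<Sum>e\<in>[S]\<^bsup>3\<^esup>. pattern_density V E (e \<union> Y) (sym_diff H {e})) \<le> d / 4 \<longrightarrow>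
     (card S)\<^sup>2 \<le> d / 4 * card V \<longrightarrow> real t \<le> c * ln (card V) \<longrightarrow>
     (\<exists>T. (\<forall>a\<in>S. T a \<subseteq> V \<and> card (T a) = t) \<and> (\<forall>a\<in>S. \<forall>b\<in>S. a \<noteq> b \<longrightarrow> T a \<inter> T b = {}) \<and>
        (\<Sum>e\<in>[S]\<^bsup>3\<^esup>. card {x \<in> PiE S T. (x ` e \<in> E) \<noteq> p}) \<le> t ^ card S)"
proof -
  obtain c d' where c: "c > 0" and d': "d' > (0::real)" and
    blowup: "\<forall>(V :: 'a set) P g t. finite V \<longrightarrow>
     (\<forall>x\<in>PiE S (\<lambda>_. V). g x \<le> (1::real)) \<longrightarrow>
     (\<forall>x\<in>PiE S (\<lambda>_. V). g x \<noteq> 0 \<longrightarrow> (\<forall>a\<in>S. \<forall>b\<in>S. a \<noteq> b \<longrightarrow> P a b (x a) (x b))) \<longrightarrow>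
     d / 2 * real (card V) ^ card S \<le> (\<Sum>x\<in>PiE S (\<lambda>_. V). g x) \<longrightarrow>
     real t \<le> c * ln (card V) \<longrightarrow>
     (\<exists>T. (\<forall>a\<in>S. T a \<subseteq> V \<and> card (T a) = t) \<and>
        (\<forall>a\<in>S. \<forall>b\<in>S. a \<noteq> b \<longrightarrow> (\<forall>u\<in>T a. \<forall>v\<in>T b. P a b u v)) \<and>
        d' * real t ^ card S \<le> (\<Sum>x\<in>PiE S T. g x))"
    using log_blowup[OF assms(1) half_gt_zero[OF assms(4)]] by (elim exE conjE)
  have "\<exists>T. (\<forall>a\<in>S. T a \<subseteq> V \<and> card (T a) = t) \<and> (\<forall>a\<in>S. \<forall>b\<in>S. a \<noteq> b \<longrightarrow> T a \<inter> T b = {}) \<and>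
        (\<Sum>e\<in>[S]\<^bsup>3\<^esup>. card {x \<in> PiE S T. (x ` e \<in> E) \<noteq> p}) \<le> t ^ card S"
    if V: "finite V" "V \<noteq> {}" and dens: "d \<le> pattern_density V E (S \<union> Y) H"
      and bad: "(\<Sum>e\<in>[S]\<^bsup>3\<^esup>. pattern_density V E (e \<union> Y) (sym_diff H {e})) \<le> d / 4"
      and large: "(card S)\<^sup>2 \<le> d / 4 * card V" and t: "real t \<le> c * ln (card V)"
    for V :: "'a set" and E t
  proof -
    let ?P = "\<lambda>A. PiE A (\<lambda>_. V)" and ?T = "[S]\<^bsup>3\<^esup>"
    define n where "n = real (card V)"
    have n: "n > 0" unfolding n_def using V by (simp add: card_gt_0_iff)
    have fT: "finite ?T" using assms(1) by (rule finite_imp_finite_nsets)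
    have fA: "finite (S \<union> Y)" "finite (?P (S \<union> Y))" using assms V by (auto simp: finite_PiE)
    \<comment> \<open>Distinctness belongs to the clique condition so that the parts obtained from
      the blow-up are pairwise disjoint.\<close>
    define cliq where "cliq z \<longleftrightarrow> (\<forall>a\<in>S. \<forall>b\<in>S. a \<noteq> b \<longrightarrow> z a \<noteq> z b \<and>
       restrict z ({a, b} \<union> Y) \<in> occurrences V E ({a, b} \<union> Y) H)" for z
    \<comment> \<open>One weight for both aims, many cliques and few wrong triples. It is at most
      \<open>1\<close> but can be negative.\<close>
    define G where "G z = of_bool (cliq z) - (\<Sum>e\<in>?T. of_bool (cliq z \<and> (z ` e \<in> E) \<noteq> p) :: real)" for z
    let ?C = "{z \<in> ?P (S \<union> Y). cliq z}" and ?B = "\<lambda>e. {z \<in> ?P (S \<union> Y). cliq z \<and> (z ` e \<in> E) \<noteq> p}"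
    let ?I = "{z \<in> ?P (S \<union> Y). \<not> inj_on z S}"
    have "(\<Sum>z\<in>?P (S \<union> Y). G z) = card ?C - (\<Sum>e\<in>?T. real (card (?B e)))"
      unfolding G_def sum_subtractf using fA
      by (subst sum.swap) (simp add: Int_def)
    moreover have "real (card (?B e)) \<le> pattern_density V E (e \<union> Y) (sym_diff H {e}) * n ^ card (S \<union> Y)"
      if e: "e \<in> ?T" for e
    proof -
      have eS: "e \<union> Y \<subseteq> S \<union> Y" "finite (e \<union> Y)" using e assms(2) by (auto simp: nsets_def)
      have "?B e \<subseteq> {z \<in> ?P (S \<union> Y). restrict z (e \<union> Y) \<in> occurrences V E (e \<union> Y) (sym_diff H {e})}"
      proof
        fix z assume "z \<in> ?B e"
        then have z: "z \<in> ?P (S \<union> Y)" "cliq z" "(z ` e \<in> E) \<noteq> p" by blast+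
        have "(z ` e \<in> E) \<noteq> (e \<in> H)" using z(3) assms(5) e by simp
        then have "restrict z (e \<union> Y) \<in> occurrences V E (e \<union> Y) (sym_diff H {e})"
          using z(2) unfolding cliq_def by (intro occurrences_sym_diff[OF e assms(3) z(1)]) blast+
        then show "z \<in> {z \<in> ?P (S \<union> Y). restrict z (e \<union> Y) \<in> occurrences V E (e \<union> Y) (sym_diff H {e})}"
          using z(1) by blast
      qed
      then have "card (?B e) \<le> card {z \<in> ?P (S \<union> Y). restrict z (e \<union> Y) \<in> occurrences V E (e \<union> Y) (sym_diff H {e})}"
        using fA(2) by (intro card_mono finite_subset[OF _ fA(2)]) blast
      also have "\<dots> = card (occurrences V E (e \<union> Y) (sym_diff H {e})) * card V ^ card (S \<union> Y - (e \<union> Y))"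
        unfolding card_PiE_restrict[OF fA(1) eS(1)]
        by (simp only: Int_absorb1[OF occurrences_subset] prod_constant)
      finally have "real (card (?B e)) \<le> real (card (occurrences V E (e \<union> Y) (sym_diff H {e})) * card V ^ card (S \<union> Y - (e \<union> Y)))"
        by (rule of_nat_mono)
      also have "\<dots> = card (occurrences V E (e \<union> Y) (sym_diff H {e})) * n ^ card (S \<union> Y - (e \<union> Y))"
        unfolding n_def by (simp only: of_nat_mult of_nat_power)
      also have "\<dots> = pattern_density V E (e \<union> Y) (sym_diff H {e}) * (n ^ card (e \<union> Y) * n ^ card (S \<union> Y - (e \<union> Y)))"
        unfolding card_occurrences[OF V] n_def by simp
      also have "n ^ card (e \<union> Y) * n ^ card (S \<union> Y - (e \<union> Y)) = n ^ card (S \<union> Y)"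
        unfolding power_add[symmetric] card_Diff_subset[OF eS(2,1)]
        using card_mono[OF fA(1) eS(1)] by (simp only: le_add_diff_inverse)
      finally show ?thesis .
    qed
    then have "(\<Sum>e\<in>?T. real (card (?B e))) \<le>
        (\<Sum>e\<in>?T. pattern_density V E (e \<union> Y) (sym_diff H {e})) * n ^ card (S \<union> Y)"
      unfolding sum_distrib_right by (rule sum_mono)
    then have "(\<Sum>e\<in>?T. real (card (?B e))) \<le> d / 4 * n ^ card (S \<union> Y)"
      
      by (rule order_trans[OF _ mult_right_mono[OF bad]]) (use n in simp)
    moreover have "d * n ^ card (S \<union> Y) - d / 4 * n ^ card (S \<union> Y) \<le> card ?C"
    proof -
      have "occurrences V E (S \<union> Y) H \<subseteq> ?C \<union> ?I"
      proof
        fix z assume z: "z \<in> occurrences V E (S \<union> Y) H"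
        have "cliq z" if inj: "inj_on z S" unfolding cliq_def
        proof (intro ballI impI conjI)
          fix a b assume ab: "a \<in> S" "b \<in> S" "a \<noteq> b"
          then show "z a \<noteq> z b" using inj by (auto dest: inj_onD)
          show "restrict z ({a, b} \<union> Y) \<in> occurrences V E ({a, b} \<union> Y) H"
            using ab by (intro restrict_occurrences[OF z]) auto
        qed
        then show "z \<in> ?C \<union> ?I" using z by (auto simp: occurrences_def)
      qed
      then have "card (occurrences V E (S \<union> Y) H) \<le> card (?C \<union> ?I)" using fA by (intro card_mono) auto
      also have "\<dots> \<le> card ?C + card ?I" by (rule card_Un_le)
      finally have 1: "real (card (occurrences V E (S \<union> Y) H)) \<le> real (card ?C) + real (card ?I)" by linarith
      have "card ?I * card V \<le> (card S)\<^sup>2 * card V ^ card (S \<union> Y)"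
        using fA V by (intro card_not_inj_on_le) auto
      then have "real (card ?I * card V) \<le> real ((card S)\<^sup>2 * card V ^ card (S \<union> Y))"
        by (rule of_nat_mono)
      then have "real (card ?I) * n \<le> real ((card S)\<^sup>2) * n ^ card (S \<union> Y)"
        unfolding n_def by (simp only: of_nat_mult of_nat_power)
      also have "\<dots> \<le> (d / 4 * n) * n ^ card (S \<union> Y)"
        using large n unfolding n_def by (intro mult_right_mono) auto
      finally have "real (card ?I) \<le> d / 4 * n ^ card (S \<union> Y)" using n by (simp add: mult_ac)
      moreover have "d * n ^ card (S \<union> Y) \<le> card (occurrences V E (S \<union> Y) H)"
        unfolding card_occurrences[OF V] n_def using dens by (intro mult_right_mono) auto
      ultimately show ?thesis using 1 by linarith
    qed
    ultimately have "d / 2 * n ^ card (S \<union> Y) \<le> (\<Sum>z\<in>?P (S \<union> Y). G z)" by linarith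
    then have "\<exists>y\<in>?P Y. d / 2 * n ^ card S \<le>
        (\<Sum>x\<in>?P S. G (\<lambda>a. if a \<in> Y then y a else x a))"
      unfolding n_def by (rule ex_fixed_coordinates[OF assms(2,3,1) V])
    then obtain y where y: "y \<in> ?P Y" "d / 2 * n ^ card S \<le>
        (\<Sum>x\<in>?P S. G (\<lambda>a. if a \<in> Y then y a else x a))"
      by (elim bexE)
    \<comment> \<open>Once the values on \<open>Y\<close> are fixed, the condition for
      \<open>a\<close> and \<open>b\<close> depends only on the images of these two vertices, so the
      cliques are those of a family of graphs.\<close>
    define P where "P a b u v \<longleftrightarrow> u \<noteq> v \<and> y(a := u, b := v) \<in> occurrences V E ({a, b} \<union> Y) H" for a b u v
    define m where "m x = (\<lambda>a. if a \<in> Y then y a else x a)" for x :: "'i \<Rightarrow> 'a"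
    have mS: "m x a = x a" if "a \<in> S" for x a using that assms(3) by (auto simp: m_def)
    have "restrict (m x) ({a, b} \<union> Y) = y(a := x a, b := x b)" if "a \<in> S" "b \<in> S" for x a b
      using that assms(3) y(1) by (auto simp: m_def fun_eq_iff PiE_iff extensional_def)
    then have cliqP: "cliq (m x) \<longleftrightarrow> (\<forall>a\<in>S. \<forall>b\<in>S. a \<noteq> b \<longrightarrow> P a b (x a) (x b))" for x
      unfolding cliq_def P_def by (simp add: mS cong: ball_cong)
    have "\<exists>T. (\<forall>a\<in>S. T a \<subseteq> V \<and> card (T a) = t) \<and>
        (\<forall>a\<in>S. \<forall>b\<in>S. a \<noteq> b \<longrightarrow> (\<forall>u\<in>T a. \<forall>v\<in>T b. P a b u v)) \<and>
        d' * real t ^ card S \<le> (\<Sum>x\<in>PiE S T. G (m x))"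
    proof (intro blowup[THEN spec, THEN spec, THEN spec, THEN spec, THEN mp, THEN mp, THEN mp, THEN mp, THEN mp] V(1) t)
      show "\<forall>x\<in>?P S. G (m x) \<le> 1" by (auto simp: G_def sum_nonneg add_increasing2)
      show "\<forall>x\<in>?P S. G (m x) \<noteq> 0 \<longrightarrow> (\<forall>a\<in>S. \<forall>b\<in>S. a \<noteq> b \<longrightarrow> P a b (x a) (x b))"
        by (auto simp: G_def simp flip: cliqP)
      show "d / 2 * real (card V) ^ card S \<le> (\<Sum>x\<in>?P S. G (m x))"
        using y(2) unfolding n_def m_def .
    qed
    then obtain T where T: "\<forall>a\<in>S. T a \<subseteq> V \<and> card (T a) = t"
        and TP: "\<forall>a\<in>S. \<forall>b\<in>S. a \<noteq> b \<longrightarrow> (\<forall>u\<in>T a. \<forall>v\<in>T b. P a b u v)"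
        and Tsum: "d' * real t ^ card S \<le> (\<Sum>x\<in>PiE S T. G (m x))"
      by (elim exE conjE)
    have fT': "finite (PiE S T)"
      using T V finite_subset assms(1) by (metis finite_PiE)
    \<comment> \<open>On the box every map is a clique, so its weight is \<open>1\<close> minus its
      number of wrong triples; nonnegativity of the sum bounds that number by \<open>1\<close> on
      average.\<close>
    have "0 \<le> (\<Sum>x\<in>PiE S T. G (m x))" 
      using d' by (intro order_trans[OF _ Tsum]) simp
    also have "\<dots> = (\<Sum>x\<in>PiE S T. 1 - (\<Sum>e\<in>?T. of_bool ((x ` e \<in> E) \<noteq> p)))"
    proof (rule sum.cong[OF refl])
      fix x assume "x \<in> PiE S T"
      then have "cliq (m x)" using TP unfolding cliqP by (auto simp: PiE_iff)
      moreover have "m x ` e = x ` e" if "e \<in> ?T" for e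
        using that mS by (intro image_cong) (auto simp: nsets_def)
      ultimately show "G (m x) = 1 - (\<Sum>e\<in>?T. of_bool ((x ` e \<in> E) \<noteq> p))"
        unfolding G_def by simp
    qed
    also have "\<dots> = real (card (PiE S T)) - (\<Sum>e\<in>?T. real (card {x \<in> PiE S T. (x ` e \<in> E) \<noteq> p}))"
      unfolding sum_subtractf using fT' by (subst sum.swap) (simp add: Int_def)
    finally have "(\<Sum>e\<in>?T. real (card {x \<in> PiE S T. (x ` e \<in> E) \<noteq> p})) \<le> card (PiE S T)" by simp
    moreover have "card (PiE S T) = t ^ card S" using T assms(1) by (simp add: card_PiE)
    ultimately have "(\<Sum>e\<in>?T. card {x \<in> PiE S T. (x ` e \<in> E) \<noteq> p}) \<le> t ^ card S"
      by (simp only: of_nat_sum[symmetric] of_nat_le_iff)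
    moreover have "\<forall>a\<in>S. \<forall>b\<in>S. a \<noteq> b \<longrightarrow> T a \<inter> T b = {}" using TP unfolding P_def by blast
    ultimately show ?thesis using T by blast
  qed
  note * = this
  show ?thesis by (rule exI[of _ c], rule conjI[OF c], intro allI impI, rule *)
qed

section \<open>Counting wrong triples in the union of the parts\<close>

lemma triple_cases:
  assumes "f \<in> [\<Union>a\<in>S. T a]\<^bsup>3\<^esup>"
  shows "(\<exists>a\<in>S. \<exists>u\<in>T a. \<exists>v\<in>T a. \<exists>w\<in>\<Union>a\<in>S. T a. f = {u, v, w}) \<or> (\<exists>e\<in>[S]\<^bsup>3\<^esup>. \<exists>y\<in>PiE e T. f = y ` e)"
proof -
  have f: "f \<subseteq> (\<Union>a\<in>S. T a)" "finite f" "card f = 3" using assms by (auto simp: nsets_def)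
  then have "\<forall>w\<in>f. \<exists>a. a \<in> S \<and> w \<in> T a" by blast
  \<comment> \<open>\<open>\<phi>\<close> assigns to each vertex a part containing it. If it is
    injective on \<open>f\<close>, its inverse exhibits \<open>f\<close> as a transversal triple;
    otherwise two vertices share a part.\<close>
  then obtain \<phi> where \<phi>: "\<And>w. w \<in> f \<Longrightarrow> \<phi> w \<in> S \<and> w \<in> T (\<phi> w)" by metis
  show ?thesis
  proof (cases "inj_on \<phi> f")
    case True
    define y where "y = restrict (inv_into f \<phi>) (\<phi> ` f)"
    have "y ` \<phi> ` f = f" using True by (auto simp: y_def image_image)
    moreover have "y \<in> PiE (\<phi> ` f) T" using \<phi> True by (auto simp: y_def)
    moreover have "\<phi> ` f \<in> [S]\<^bsup>3\<^esup>" using \<phi> f True by (auto simp: nsets_def card_image)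
    ultimately show ?thesis by metis
  next
    case False
    then obtain u v where uv: "u \<in> f" "v \<in> f" "u \<noteq> v" "\<phi> u = \<phi> v" by (auto simp: inj_on_def)
    then have "card (f - {u, v}) = 1" using f by (simp add: card_Diff_subset)
    then obtain w where "f - {u, v} = {w}" by (auto simp: card_1_singleton_iff)
    then have "f = {u, v, w}" "w \<in> f" using uv by auto
    moreover have "w \<in> (\<Union>a\<in>S. T a)" using f(1) \<open>w \<in> f\<close> by blast
    ultimately show ?thesis using \<phi>[OF uv(1)] \<phi>[OF uv(2)] uv(4) by metis
  qed
qed

text \<open>Every wrong map on a triple \<open>e\<close> extends to \<open>t ^ (card S - 3)\<close>
  maps on \<open>S\<close>, so there are at most \<open>t ^ 3\<close> wrong transversal triples. All
  triples with two vertices in one part together number at most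
  \<open>card S * t * t * (card S * t)\<close>.\<close>

lemma card_bad_triples_le:
  assumes "finite S" "3 \<le> card S" "\<And>a. a \<in> S \<Longrightarrow> finite (T a) \<and> card (T a) = t" "0 < t"
    and "(\<Sum>e\<in>[S]\<^bsup>3\<^esup>. card {x \<in> PiE S T. (x ` e \<in> E) \<noteq> p}) \<le> t ^ card S"
  shows "card {f \<in> [\<Union>a\<in>S. T a]\<^bsup>3\<^esup>. (f \<in> E) \<noteq> p} \<le> t ^ 3 + (card S)\<^sup>2 * t ^ 3"
proof -
  let ?W = "\<Union>a\<in>S. T a"
  define B where "B e = {y \<in> PiE e T. (y ` e \<in> E) \<noteq> p}" for e
  define D where "D = (\<Union>a\<in>S. T a \<times> T a \<times> ?W)"
  have fW: "finite ?W" and fT: "finite ([S]\<^bsup>3\<^esup>)"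
    using assms(1,3) finite_imp_finite_nsets by auto
  have eS: "finite e" "e \<subseteq> S" "card e = 3" if "e \<in> [S]\<^bsup>3\<^esup>" for e using that by (auto simp: nsets_def)
  have fB: "finite (B e)" if "e \<in> [S]\<^bsup>3\<^esup>" for e
  proof -
    have "finite (PiE e T)" using eS[OF that] assms(3) by (intro finite_PiE) auto
    then show ?thesis by (rule rev_finite_subset) (auto simp: B_def)
  qed
  have cW: "card ?W \<le> card S * t"
    using card_UN_le[OF assms(1), of T] assms(3) by simp
  have fD: "finite D" unfolding D_def using assms(1,3) fW by auto
  have "card D \<le> (\<Sum>a\<in>S. card (T a \<times> T a \<times> ?W))" unfolding D_def using assms(1) by (rule card_UN_le)
  also have "\<dots> = card S * (t * (t * card ?W))" using assms(3) by (simp add: card_cartesian_product)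
  also have "\<dots> \<le> card S * (t * (t * (card S * t)))" using cW by (intro mult_le_mono2)
  also have "\<dots> = (card S)\<^sup>2 * t ^ 3" by (simp add: power2_eq_square power3_eq_cube mult_ac)
  finally have cD: "card D \<le> (card S)\<^sup>2 * t ^ 3" .
  have "card {x \<in> PiE S T. (x ` e \<in> E) \<noteq> p} = card (B e) * t ^ (card S - 3)" if e: "e \<in> [S]\<^bsup>3\<^esup>" for e
  proof -
    have "{x \<in> PiE S T. (x ` e \<in> E) \<noteq> p} = {x \<in> PiE S T. restrict x e \<in> {y. (y ` e \<in> E) \<noteq> p}}"
      by simp
    also have "card \<dots> = card (PiE e T \<inter> {y. (y ` e \<in> E) \<noteq> p}) * (\<Prod>a\<in>S-e. card (T a))"
      using assms(1) eS[OF e] by (intro card_PiE_restrict) auto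
    also have "(\<Prod>a\<in>S-e. card (T a)) = t ^ card (S - e)" using assms(3) by simp
    also have "card (S - e) = card S - 3" using eS[OF e] by (simp add: card_Diff_subset)
    also have "PiE e T \<inter> {y. (y ` e \<in> E) \<noteq> p} = B e" by (auto simp: B_def)
    finally show ?thesis .
  qed
  then have "(\<Sum>e\<in>[S]\<^bsup>3\<^esup>. card (B e)) * t ^ (card S - 3) \<le> t ^ card S"
    using assms(5) by (simp add: sum_distrib_right)
  also have "t ^ card S = t ^ 3 * t ^ (card S - 3)" using assms(2) by (simp flip: power_add)
  finally have sB: "(\<Sum>e\<in>[S]\<^bsup>3\<^esup>. card (B e)) \<le> t ^ 3" using assms(4) by simp
  have "{f \<in> [?W]\<^bsup>3\<^esup>. (f \<in> E) \<noteq> p} \<subseteq> (\<Union>e\<in>[S]\<^bsup>3\<^esup>. (\<lambda>y. y ` e) ` B e) \<union> (\<lambda>(u, v, w). {u, v, w}) ` D"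
  proof
    fix f assume f: "f \<in> {f \<in> [?W]\<^bsup>3\<^esup>. (f \<in> E) \<noteq> p}"
    then have "f \<in> [?W]\<^bsup>3\<^esup>" by blast
    from triple_cases[OF this] show "f \<in> (\<Union>e\<in>[S]\<^bsup>3\<^esup>. (\<lambda>y. y ` e) ` B e) \<union> (\<lambda>(u, v, w). {u, v, w}) ` D"
    proof (elim disjE bexE)
      fix a u v w assume "a \<in> S" "u \<in> T a" "v \<in> T a" "w \<in> ?W" "f = {u, v, w}"
      then have "(u, v, w) \<in> D" "f = (\<lambda>(u, v, w). {u, v, w}) (u, v, w)" unfolding D_def by blast+
      then show ?thesis by blast
    next
      fix e y assume e: "e \<in> [S]\<^bsup>3\<^esup>" "y \<in> PiE e T" "f = y ` e"
      then have "y \<in> B e" using f by (simp add: B_def)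
      then show ?thesis using e by blast
    qed
  qed
  then have "card {f \<in> [?W]\<^bsup>3\<^esup>. (f \<in> E) \<noteq> p} \<le>
      card ((\<Union>e\<in>[S]\<^bsup>3\<^esup>. (\<lambda>y. y ` e) ` B e) \<union> (\<lambda>(u, v, w). {u, v, w}) ` D)"
    using fT fB fD by (intro card_mono finite_UnI finite_UN_I finite_imageI)
  also have "\<dots> \<le> card (\<Union>e\<in>[S]\<^bsup>3\<^esup>. (\<lambda>y. y ` e) ` B e) + card ((\<lambda>(u, v, w). {u, v, w}) ` D)"
    by (rule card_Un_le)
  also have "\<dots> \<le> (\<Sum>e\<in>[S]\<^bsup>3\<^esup>. card (B e)) + card D"
    using fT fB fD by (intro add_mono order_trans[OF card_UN_le] sum_mono card_image_le)
  finally show ?thesis using sB cD by linarith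
qed

text \<open>Deleting a suitable vertex does not raise the density of the triples with
  \<open>Q\<close>: each triple survives \<open>n - 3\<close> of the \<open>n\<close> deletions, and
  \<open>(n - 3) * (n choose 3) = n * (n - 1 choose 3)\<close>. This allows a homogeneous set to be
  cut to the exact size required.\<close>

lemma ex_subset_few_triples:
  fixes \<eta> :: real
  assumes "finite W" "s \<le> card W" "card {f \<in> [W]\<^bsup>3\<^esup>. Q f} \<le> \<eta> * (card W choose 3)"
  shows "\<exists>W'\<subseteq>W. card W' = s \<and> card {f \<in> [W']\<^bsup>3\<^esup>. Q f} \<le> \<eta> * (s choose 3)"
  using assms
proof (induction "card W - s" arbitrary: W)
  case 0
  then show ?case by (intro exI[of _ W]) auto
next
  case (Suc k)
  let ?F = "\<lambda>W. {f \<in> [W]\<^bsup>3\<^esup>. Q f}" and ?n = "card W"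
  have n: "?n > 0" using Suc.hyps(2) by simp
  have fF: "finite (?F W)" using finite_imp_finite_nsets[OF Suc.prems(1)] by simp
  have F: "?F (W - {w}) = {f \<in> ?F W. w \<notin> f}" for w by (auto simp: nsets_def)
  have "(\<Sum>w\<in>W. card (?F (W - {w}))) = (\<Sum>w\<in>W. \<Sum>f\<in>?F W. of_bool (w \<notin> f))"
    unfolding F using fF by (simp add: Int_def)
  also have "\<dots> = (\<Sum>f\<in>?F W. \<Sum>w\<in>W. of_bool (w \<notin> f))" by (rule sum.swap)
  also have "\<dots> = (\<Sum>f\<in>?F W. ?n - 3)"
  proof (rule sum.cong[OF refl])
    fix f assume "f \<in> ?F W"
    then have "f \<subseteq> W" "finite f" "card f = 3" by (auto simp: nsets_def)
    moreover have "W \<inter> {w. w \<notin> f} = W - f" by blast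
    ultimately show "(\<Sum>w\<in>W. of_bool (w \<notin> f)) = ?n - 3"
      using Suc.prems(1) by (simp add: card_Diff_subset)
  qed
  finally have dc: "(\<Sum>w\<in>W. card (?F (W - {w}))) = card (?F W) * (?n - 3)" by simp
  have "\<exists>w\<in>W. ?n * card (?F (W - {w})) \<le> card (?F W) * (?n - 3)"
  proof (rule ccontr)
    assume "\<not> ?thesis"
    then have "(\<Sum>w\<in>W. card (?F W) * (?n - 3)) < (\<Sum>w\<in>W. ?n * card (?F (W - {w})))"
      using Suc.prems(1) n by (intro sum_strict_mono) (auto simp: not_le)
    then show False using dc by (simp flip: sum_distrib_left)
  qed
  then obtain w where w: "w \<in> W" "?n * card (?F (W - {w})) \<le> card (?F W) * (?n - 3)" by blast
  have "real ?n * card (?F (W - {w})) \<le> card (?F W) * real (?n - 3)"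
    using of_nat_mono[OF w(2), where 'a = real] by simp
  also have "\<dots> \<le> (\<eta> * (?n choose 3)) * real (?n - 3)"
    using Suc.prems(3) by (intro mult_right_mono) auto
  also have "\<dots> = \<eta> * real ((?n - 3) * (?n choose 3))" by simp
  also have "\<dots> = real ?n * (\<eta> * (card (W - {w}) choose 3))"
    using binomial_absorb_comp[of ?n 3] w(1) Suc.prems(1) by simp
  finally have "card (?F (W - {w})) \<le> \<eta> * (card (W - {w}) choose 3)"
    using n by simp
  moreover have "k = card (W - {w}) - s" "s \<le> card (W - {w})" "finite (W - {w})"
    using Suc.hyps(2) w(1) Suc.prems(1) by auto
  ultimately show ?case using Suc.hyps(1)[of "W - {w}"] by blast
qed

section \<open>Homogeneity of the union of the parts\<close>

lemma homogeneous_if_few_bad_triples: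
  fixes \<eta> :: real
  assumes "finite W" "card {f \<in> [W]\<^bsup>3\<^esup>. (f \<in> E) \<noteq> p} \<le> \<eta> * (card W choose 3)"
  shows "homogeneous \<eta> E W"
proof (cases p)
  case True
  have fin: "finite ([W]\<^bsup>3\<^esup>)" using assms(1) by (rule finite_imp_finite_nsets)
  have "card ([W]\<^bsup>3\<^esup>) = card (E \<inter> [W]\<^bsup>3\<^esup>) + card {f \<in> [W]\<^bsup>3\<^esup>. (f \<in> E) \<noteq> p}"
  proof (subst card_Un_disjoint[symmetric])
    show "card ([W]\<^bsup>3\<^esup>) = card (E \<inter> [W]\<^bsup>3\<^esup> \<union> {f \<in> [W]\<^bsup>3\<^esup>. (f \<in> E) \<noteq> p})"
      using True by (intro arg_cong[where f = card]) blast
  qed (use fin True in auto)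
  then have "real (card W choose 3) = spanned_edges E W + real (card {f \<in> [W]\<^bsup>3\<^esup>. (f \<in> E) \<noteq> p})"
    by (simp add: spanned_edges_def)
  then show ?thesis using assms(2) by (simp add: homogeneous_def algebra_simps)
next
  case False
  then have "{f \<in> [W]\<^bsup>3\<^esup>. (f \<in> E) \<noteq> p} = E \<inter> [W]\<^bsup>3\<^esup>" by auto
  then show ?thesis using assms(2) by (simp add: homogeneous_def spanned_edges_def)
qed

lemma real_choose_3: "real (n choose 3) = real n * (real n - 1) * (real n - 2) / 6"
proof (induction n)
  case (Suc n)
  have "real (n choose 2) = real n * (real n - 1) / 2"
  proof (induction n)
    case (Suc n)
    then show ?case by (simp add: numeral_2_eq_2 field_simps)
  qed simp
  with Suc show ?case by (simp add: numeral_3_eq_3 numeral_2_eq_2 field_simps)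
qed simp

text \<open>From \<open>n = 4\<close> on, \<open>n - 1 \<ge> 3 * n / 4\<close> and
  \<open>n - 2 \<ge> n / 2\<close>; the constant is \<open>16 = 6 * (4 / 3) * 2\<close>.\<close>

lemma cube_le_choose_3: "4 \<le> n \<Longrightarrow> real n ^ 3 \<le> 16 * real (n choose 3)"
proof -
  assume n: "4 \<le> n"
  have "real n * ((3 / 4 * real n) * (1 / 2 * real n)) \<le> real n * ((real n - 1) * (real n - 2))"
    using n by (intro mult_left_mono mult_mono) auto
  moreover have "real n * ((real n - 1) * (real n - 2)) = 6 * real (n choose 3)"
    by (simp add: real_choose_3)
  ultimately show ?thesis by (simp add: power3_eq_cube)
qed

lemma homogeneous_small: "card W \<le> 2 \<Longrightarrow> finite W \<Longrightarrow> homogeneous \<eta> E W"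
  by (simp add: homogeneous_def spanned_edges_def nsets_eq_empty binomial_eq_0)

text \<open>With \<open>m = card S\<close> parts of size \<open>t\<close>, at most
  \<open>2 * m^2 * t^3\<close> triples of the union are wrong, while \<open>\<eta>\<close> times the
  number of all triples is at least \<open>\<eta> * m^3 * t^3 / 16\<close>. This is the origin of
  the requirement \<open>m \<ge> 32 / \<eta>\<close>.\<close>

lemma ex_homogeneous_of_pattern:
  fixes S Y :: "'i set" and d \<eta> :: real
  assumes "finite S" "finite Y" "S \<inter> Y = {}" "d > 0" "\<forall>e\<in>[S]\<^bsup>3\<^esup>. e \<in> H \<longleftrightarrow> p"
    and "\<eta> > 0" "4 \<le> card S" "32 / \<eta> \<le> card S"
  shows "\<exists>c>0. \<forall>(V :: 'a set) E s. finite V \<longrightarrow> V \<noteq> {} \<longrightarrow>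
     d \<le> pattern_density V E (S \<union> Y) H \<longrightarrow>
     (\<Sum>e\<in>[S]\<^bsup>3\<^esup>. pattern_density V E (e \<union> Y) (sym_diff H {e})) \<le> d / 4 \<longrightarrow>
     (card S)\<^sup>2 \<le> d / 4 * card V \<longrightarrow> 4 \<le> c * ln (card V) \<longrightarrow> real s \<le> c * ln (card V) \<longrightarrow>
     (\<exists>W\<subseteq>V. card W = s \<and> homogeneous \<eta> E W)"
proof -
  let ?m = "card S"
  obtain c where c: "c > 0" and parts: "\<forall>(V :: 'a set) E t. finite V \<longrightarrow> V \<noteq> {} \<longrightarrow>
     d \<le> pattern_density V E (S \<union> Y) H \<longrightarrow>
     (\<Sum>e\<in>[S]\<^bsup>3\<^esup>. pattern_density V E (e \<union> Y) (sym_diff H {e})) \<le> d / 4 \<longrightarrow>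
     (card S)\<^sup>2 \<le> d / 4 * card V \<longrightarrow> real t \<le> c * ln (card V) \<longrightarrow>
     (\<exists>T. (\<forall>a\<in>S. T a \<subseteq> V \<and> card (T a) = t) \<and> (\<forall>a\<in>S. \<forall>b\<in>S. a \<noteq> b \<longrightarrow> T a \<inter> T b = {}) \<and>
        (\<Sum>e\<in>[S]\<^bsup>3\<^esup>. card {x \<in> PiE S T. (x ` e \<in> E) \<noteq> p}) \<le> t ^ card S)"
    using ex_log_parts[OF assms(1-5)] by (elim exE conjE)
  have "\<exists>W\<subseteq>V. card W = s \<and> homogeneous \<eta> E W"
    if V: "finite V" "V \<noteq> {}" and dens: "d \<le> pattern_density V E (S \<union> Y) H"
      and bad: "(\<Sum>e\<in>[S]\<^bsup>3\<^esup>. pattern_density V E (e \<union> Y) (sym_diff H {e})) \<le> d / 4"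
      and large: "(card S)\<^sup>2 \<le> d / 4 * card V" "4 \<le> c * ln (card V)"
      and s: "real s \<le> c * ln (card V)"
    for V :: "'a set" and E s
  proof -
    \<comment> \<open>The bound \<open>4 \<le> c * ln (card V)\<close> keeps \<open>t\<close>
      positive after rounding down, so \<open>s \<le> t + 1 \<le> 2 * t \<le> card S * t\<close>,
      and the union has room for \<open>s\<close> vertices.\<close>
    define t where "t = nat \<lfloor>c * ln (card V)\<rfloor>"
    have t: "real t \<le> c * ln (card V)" "c * ln (card V) \<le> real t + 1" "1 \<le> t"
      using large(2) unfolding t_def by linarith+
    have "\<exists>T. (\<forall>a\<in>S. T a \<subseteq> V \<and> card (T a) = t) \<and> (\<forall>a\<in>S. \<forall>b\<in>S. a \<noteq> b \<longrightarrow> T a \<inter> T b = {}) \<and>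
        (\<Sum>e\<in>[S]\<^bsup>3\<^esup>. card {x \<in> PiE S T. (x ` e \<in> E) \<noteq> p}) \<le> t ^ card S"
      by (rule parts[THEN spec, THEN spec, THEN spec, THEN mp, THEN mp, THEN mp, THEN mp, THEN mp, THEN mp,
          OF V dens bad large(1) t(1)])
    then obtain T where T: "\<forall>a\<in>S. T a \<subseteq> V \<and> card (T a) = t"
        and disj: "\<forall>a\<in>S. \<forall>b\<in>S. a \<noteq> b \<longrightarrow> T a \<inter> T b = {}"
        and few: "(\<Sum>e\<in>[S]\<^bsup>3\<^esup>. card {x \<in> PiE S T. (x ` e \<in> E) \<noteq> p}) \<le> t ^ card S"
      by (elim exE conjE)
    let ?W = "\<Union>a\<in>S. T a"
    have fT: "finite (T a) \<and> card (T a) = t" if "a \<in> S" for a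
      using T V(1) that finite_subset by blast
    have W: "?W \<subseteq> V" "finite ?W" using T fT assms(1) by auto
    have cW: "card ?W = ?m * t"
      using card_UN_disjoint[OF assms(1), of T] fT disj by simp
    have "real (t ^ 3 + ?m\<^sup>2 * t ^ 3) \<le> real (2 * ?m\<^sup>2 * t ^ 3)"
      using assms(7) by (intro of_nat_mono) (simp add: power2_eq_square)
    also have "\<dots> = (32 * real ?m ^ 2) * real t ^ 3 / 16" by simp
    also have "\<dots> \<le> (\<eta> * real ?m ^ 3) * real t ^ 3 / 16"
    proof -
      have "32 * real ?m ^ 2 \<le> (\<eta> * ?m) * real ?m ^ 2"
        using assms(6,8) by (intro mult_right_mono) (auto simp: field_simps)
      also have "\<dots> = \<eta> * real ?m ^ 3" by (simp add: power2_eq_square power3_eq_cube)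
      finally show ?thesis by (intro divide_right_mono mult_right_mono) auto
    qed
    also have "\<dots> = \<eta> / 16 * real (?m * t) ^ 3" by (simp add: power_mult_distrib)
    also have "\<dots> \<le> \<eta> / 16 * (16 * real (?m * t choose 3))"
    proof (intro mult_left_mono cube_le_choose_3)
      show "4 \<le> ?m * t" using assms(7) t(3) mult_le_mono[of 4 ?m 1 t] by simp
    qed (use assms(6) in simp)
    finally have "real (t ^ 3 + ?m\<^sup>2 * t ^ 3) \<le> \<eta> * (card ?W choose 3)" by (simp add: cW)
    moreover have "card {f \<in> [?W]\<^bsup>3\<^esup>. (f \<in> E) \<noteq> p} \<le> t ^ 3 + ?m\<^sup>2 * t ^ 3"
      using assms(7) t(3) by (intro card_bad_triples_le[OF assms(1) _ fT _ few]) auto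
    ultimately have bad: "real (card {f \<in> [?W]\<^bsup>3\<^esup>. (f \<in> E) \<noteq> p}) \<le> \<eta> * real (card ?W choose 3)"
      by linarith
    have sW: "s \<le> card ?W"
    proof -
      have "real s \<le> real (2 * t)" using s t by linarith
      then have "s \<le> 2 * t" by linarith
      also have "\<dots> \<le> ?m * t" using assms(7) by (intro mult_le_mono1) simp
      finally show ?thesis unfolding cW .
    qed
    obtain W' where W': "W' \<subseteq> ?W" "card W' = s" "card {f \<in> [W']\<^bsup>3\<^esup>. (f \<in> E) \<noteq> p} \<le> \<eta> * (s choose 3)"
      using ex_subset_few_triples[OF W(2) sW bad] by (elim exE conjE)
    have "homogeneous \<eta> E W'"
      using W'(3) finite_subset[OF W'(1) W(2)] unfolding W'(2)[symmetric]
      by (rule homogeneous_if_few_bad_triples[rotated])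
    then show ?thesis using W'(1,2) W(1) by blast
  qed
  note * = this
  show ?thesis by (rule exI[of _ c], rule conjI[OF c], intro allI impI, rule *)
qed

section \<open>Compactness and the final contradiction\<close>

lemma not_induced_free:
  fixes K :: "'i set" and VF :: "'b set"
  assumes "finite V" "V \<noteq> {}" "bij_betw h VF K" "finite VF"
    and "(card K)\<^sup>2 < pattern_density V E K ((`) h ` EF) * card V" "EF \<subseteq> [VF]\<^bsup>3\<^esup>"
  shows "\<not> induced_free VF EF V E"
proof -
  let ?O = "occurrences V E K ((`) h ` EF)"
  have K: "finite K" "h ` VF = K" "inj_on h VF" using assms(3,4) by (auto simp: bij_betw_def)
  have n: "real (card V) > 0" using assms(1,2) by (simp add: card_gt_0_iff)
  \<comment> \<open>There are fewer non-injective maps than occurrences of the copied pattern, so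
    some occurrence is injective; composed with \<open>h\<close>, it is an induced copy.\<close>
  have "real (card {z \<in> PiE K (\<lambda>_. V). \<not> inj_on z K} * card V) \<le> real ((card K)\<^sup>2 * card V ^ card K)"
    using K(1) assms(1) by (intro of_nat_mono card_not_inj_on_le) auto
  also have "\<dots> = real ((card K)\<^sup>2) * real (card V) ^ card K" by simp
  also have "\<dots> < (pattern_density V E K ((`) h ` EF) * card V) * real (card V) ^ card K"
    using assms(5) n by (intro mult_strict_right_mono) auto
  also have "\<dots> = real (card ?O * card V)"
    using card_occurrences[OF assms(1,2), of E K "(`) h ` EF"] by simp
  finally have lt: "card {z \<in> PiE K (\<lambda>_. V). \<not> inj_on z K} < card ?O" using n by simp
  have "\<not> ?O \<subseteq> {z \<in> PiE K (\<lambda>_. V). \<not> inj_on z K}"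
  proof
    assume "?O \<subseteq> {z \<in> PiE K (\<lambda>_. V). \<not> inj_on z K}"
    then have "card ?O \<le> card {z \<in> PiE K (\<lambda>_. V). \<not> inj_on z K}"
      using K(1) assms(1) by (intro card_mono) (auto simp: finite_PiE)
    then show False using lt by simp
  qed
  then obtain x where x: "x \<in> ?O" "inj_on x K" using occurrences_subset by blast
  have "(x \<circ> h) ` e \<in> E \<longleftrightarrow> e \<in> EF" if e: "e \<in> [VF]\<^bsup>3\<^esup>" for e
  proof -
    have "h ` e \<in> [K]\<^bsup>3\<^esup>" using e by (rule nsets_image[OF K(3)]) (use K(2) in simp)
    then have "x ` h ` e \<in> E \<longleftrightarrow> h ` e \<in> (`) h ` EF" using x(1) unfolding occurrences_def by blast
    also have "\<dots> \<longleftrightarrow> e \<in> EF"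
    proof
      assume "h ` e \<in> (`) h ` EF"
      then obtain f where f: "f \<in> EF" "h ` e = h ` f" by blast
      then have "e = f"
        using inj_on_image_eq_iff[OF K(3), of e f] e assms(6) by (auto simp: nsets_def)
      then show "e \<in> EF" using f by simp
    qed blast
    finally show ?thesis by (simp add: image_image)
  qed
  moreover have "inj_on (x \<circ> h) VF" using x(2) K by (auto intro: comp_inj_on)
  moreover have "(x \<circ> h) ` VF \<subseteq> V" using x(1) K(2) by (auto simp: occurrences_def)
  ultimately show ?thesis unfolding induced_free_def by blast
qed

text \<open>Once \<open>H\<close> is cut down to the triples of \<open>A\<close>, there are only
  countably many finite patterns over \<open>nat\<close>, and their densities lie in
  \<open>[0, 1]\<close>; a diagonal argument makes all of them converge.\<close>

lemma ex_convergent_subsequence: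
  fixes V :: "nat \<Rightarrow> 'a set"
  assumes "\<And>i. finite (V i)" "\<And>i. V i \<noteq> {}"
  obtains k where "strict_mono k" "convergent_patterns (V \<circ> k) (E \<circ> k)"
proof -
  let ?Q = "Fpow UNIV \<times> Fpow (Fpow UNIV) :: (nat set \<times> nat set set) set"
  let ?f = "\<lambda>i (A, H). pattern_density (V i) (E i) A H"
  have "countable ?Q" by (intro countable_SIGMA countable_Fpow) auto
  moreover have "norm (?f i q) \<le> 1" if "q \<in> ?Q" for i q
  proof -
    obtain A H where q: "q = (A, H)" by (cases q)
    then have "finite A" using that by (simp add: Fpow_def)
    then show ?thesis
      using pattern_density_le_1[OF assms(1)] pattern_density_nonneg[of "V i" "E i" A H]
      by (simp add: q)
  qed
  ultimately obtain k where k: "strict_mono k" "\<And>q. q \<in> ?Q \<Longrightarrow> \<exists>l. (\<lambda>i. ?f (k i) q) \<longlonglongrightarrow> l"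
    using function_convergent_subsequence[of ?Q ?f 1] by blast
  have "convergent (\<lambda>i. pattern_density ((V \<circ> k) i) ((E \<circ> k) i) A H)" if A: "finite A" for A :: "nat set" and H
  proof -
    have "(A, H \<inter> [A]\<^bsup>3\<^esup>) \<in> ?Q"
      using A finite_imp_finite_nsets[OF A, of 3] by (auto simp: Fpow_def nsets_def)
    then have "convergent (\<lambda>i. pattern_density (V (k i)) (E (k i)) A (H \<inter> [A]\<^bsup>3\<^esup>))"
      using k(2) unfolding convergent_def by fastforce
    moreover have "pattern_density V' E' A (H \<inter> [A]\<^bsup>3\<^esup>) = pattern_density V' E' A H" for V' :: "'a set" and E'
      unfolding pattern_density_def using occurrences_cong[of A "H \<inter> [A]\<^bsup>3\<^esup>" H V' E'] by simp
    ultimately show ?thesis by simp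
  qed
  then have "convergent_patterns (V \<circ> k) (E \<circ> k)"
    using assms by unfold_locales auto
  with k(1) show ?thesis by (rule that)
qed

theorem theorem1p1:
  fixes VF :: "'b set" and EF :: "'b set set" and \<eta> :: real
  assumes "three_graph VF EF" and "\<eta> > 0"
  shows "\<exists>c::real. c > 0 \<and>
    (\<forall>(V :: 'a set) (E :: 'a set set).
       three_graph V E \<and> induced_free VF EF V E \<longrightarrow>
       (\<exists>W \<subseteq> V. card W = nat \<lceil>c * ln (real (card V))\<rceil> \<and> homogeneous \<eta> E W))"
proof (rule ccontr)
  assume contra: "\<not> ?thesis"
  have VF: "finite VF" "EF \<subseteq> [VF]\<^bsup>3\<^esup>" using assms(1) by (auto simp: three_graph_def)
  let ?s = "\<lambda>i (V :: 'a set). nat \<lceil>1 / real (Suc i) * ln (card V)\<rceil>"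
  have "\<exists>V E. three_graph V E \<and> induced_free VF EF V E \<and> \<not> (\<exists>W\<subseteq>V. card W = ?s i V \<and> homogeneous \<eta> E W)" for i
    using contra by (metis of_nat_0_less_iff zero_less_Suc zero_less_divide_1_iff)
  then obtain V0 :: "nat \<Rightarrow> 'a set" and E0 where G0: "\<And>i. three_graph (V0 i) (E0 i)"
    "\<And>i. induced_free VF EF (V0 i) (E0 i)"
    "\<And>i. \<not> (\<exists>W\<subseteq>V0 i. card W = ?s i (V0 i) \<and> homogeneous \<eta> (E0 i) W)"
    by metis
  have fV0: "finite (V0 i)" for i using G0(1) by (auto simp: three_graph_def)
  \<comment> \<open>If the logarithm were at most \<open>2 * (i + 1)\<close>, the required size
    would be at most \<open>2\<close>, and sets of at most two vertices are trivially homogeneous.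
    So the counterexamples become large.\<close>
  have big: "2 * real (Suc i) < ln (card (V0 i))" for i
  proof (rule ccontr)
    assume small: "\<not> ?thesis"
    have "?s i (V0 i) \<le> 2" using small by (simp add: field_simps)
    moreover have "?s i (V0 i) \<le> card (V0 i)"
    proof (cases "card (V0 i) = 0")
      case False
      then have "0 \<le> ln (card (V0 i))" "ln (card (V0 i)) \<le> card (V0 i)"
        using ln_le_minus_one[of "card (V0 i)"] by auto
      moreover from this have "ln (card (V0 i)) / real (Suc i) \<le> ln (card (V0 i))"
        by (simp add: divide_le_eq mult_le_cancel_left1)
      ultimately show ?thesis by (simp add: nat_le_iff ceiling_le_iff)
    qed simp
    then obtain W where W: "W \<subseteq> V0 i" "card W = ?s i (V0 i)" by (meson obtain_subset_with_card_n)
    ultimately have "homogeneous \<eta> (E0 i) W"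
      using homogeneous_small finite_subset[OF _ fV0] by metis
    then show False using G0(3) W by blast
  qed
  have big': "real i < card (V0 i)" for i
  proof -
    \<comment> \<open>The convention \<open>ln 0 = 0\<close> makes an empty vertex set contradict
      \<open>big\<close>.\<close>
    have "card (V0 i) \<noteq> 0" using big[of i] by (metis ln_0 of_nat_0 of_nat_0_le_iff mult_nonneg_nonneg not_le zero_le_numeral)
    then show ?thesis using big[of i] ln_le_minus_one[of "card (V0 i)"] by simp
  qed
  have nV0: "V0 i \<noteq> {}" for i using big'[of i] by auto
  obtain k where k: "strict_mono k" and "convergent_patterns (V0 \<circ> k) (E0 \<circ> k)"
    using ex_convergent_subsequence[of V0 E0] fV0 nV0 by blast
  then interpret convergent_patterns "V0 \<circ> k" "E0 \<circ> k" by blast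
  have "filterlim (\<lambda>i. ln (real (card (V0 (k i))))) at_top sequentially"
  proof (rule filterlim_at_top_mono[OF filterlim_real_sequentially])
    have "real i \<le> ln (real (card (V0 (k i))))" for i
      using big[of "k i"] seq_suble[OF k, of i] by simp
    then show "\<forall>\<^sub>F i in sequentially. real i \<le> ln (real (card (V0 (k i))))" by simp
  qed
  then have lnV: "\<forall>\<^sub>F i in sequentially. C \<le> ln (real (card (V0 (k i))))" for C
    by (simp add: filterlim_at_top)
  have cV: "\<forall>\<^sub>F i in sequentially. C < real (card (V0 (k i)))" for C
  proof -
    have "\<forall>\<^sub>F i in sequentially. C < real i"
      using filterlim_real_sequentially by (simp add: filterlim_at_top_dense)
    then show ?thesis
      by eventually_elim (use big' seq_suble[OF k] in \<open>meson le_less_trans less_trans of_nat_le_iff order_less_le_trans\<close>)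
  qed
  \<comment> \<open>The number of parts that \<open>ex_homogeneous_of_pattern\<close> asks
    for.\<close>
  define m where "m = max 4 (nat \<lceil>32 / \<eta>\<rceil>)"
  have m: "4 \<le> m" "32 / \<eta> \<le> m" unfolding m_def by linarith+
  consider K where "finite K" "card K = card VF" "\<forall>H. pos K H"
    | S Y H p where "finite S" "finite Y" "S \<inter> Y = {}" "card S = m" "pos (S \<union> Y) H"
        "\<forall>e\<in>[S]\<^bsup>3\<^esup>. (e \<in> H \<longleftrightarrow> p) \<and> locked (e \<union> Y) H e"
    using all_patterns_or_locked[of "card VF" m] by (elim disjE exE conjE)
  then show False
  proof cases
    case 1
    obtain h where h: "bij_betw h VF K" using finite_same_card_bij[OF VF(1) 1(1)] 1(2) by auto
    \<comment> \<open>The pattern copied from \<open>(VF, EF)\<close> eventually has more than half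
      of its limit density, while the proportion of non-injective maps tends to
      \<open>0\<close>.\<close>
    define \<delta> where "\<delta> = limit_density K ((`) h ` EF)"
    have \<delta>: "\<delta> > 0" using 1(3) by (simp add: \<delta>_def)
    have "\<forall>\<^sub>F i in sequentially. \<delta> / 2 < pattern_density ((V0 \<circ> k) i) ((E0 \<circ> k) i) K ((`) h ` EF)"
      using limit_density[OF 1(1)] \<delta> unfolding \<delta>_def by (intro order_tendstoD(1)) auto
    with cV[of "2 * (card K)\<^sup>2 / \<delta>"]
    have "\<forall>\<^sub>F i in sequentially. False"
    proof eventually_elim
      case (elim i)
      have "(card K)\<^sup>2 < \<delta> / 2 * card (V0 (k i))" using elim(1) \<delta> by (simp add: field_simps)
      also have "\<dots> \<le> pattern_density (V0 (k i)) (E0 (k i)) K ((`) h ` EF) * card (V0 (k i))"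
        using elim(2) by (intro mult_right_mono) auto
      finally show False
        using not_induced_free[OF fV0 nV0 h VF(1) _ VF(2)] G0(2) by blast
    qed
    then show False by simp
  next
    case 2
    \<comment> \<open>Half of the limit density is eventually exceeded. The flipped densities of the
      locked triples have limits at most \<open>0\<close>, so their sum eventually stays below
      \<open>d / 4\<close>.\<close>
    define d where "d = limit_density (S \<union> Y) H / 2"
    have d: "d > 0" using 2(5) by (simp add: d_def)
    have mono: "\<forall>e\<in>[S]\<^bsup>3\<^esup>. e \<in> H \<longleftrightarrow> p" using 2(6) by blast
    have "4 \<le> card S" "32 / \<eta> \<le> card S" using m 2(4) by simp_all
    from ex_homogeneous_of_pattern[OF 2(1-3) d mono assms(2) this, where 'a = 'a]
    obtain c where c: "c > 0" and hom: "\<forall>(V :: 'a set) E s. finite V \<longrightarrow> V \<noteq> {} \<longrightarrow>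
       d \<le> pattern_density V E (S \<union> Y) H \<longrightarrow>
       (\<Sum>e\<in>[S]\<^bsup>3\<^esup>. pattern_density V E (e \<union> Y) (sym_diff H {e})) \<le> d / 4 \<longrightarrow>
       (card S)\<^sup>2 \<le> d / 4 * card V \<longrightarrow> 4 \<le> c * ln (card V) \<longrightarrow> real s \<le> c * ln (card V) \<longrightarrow>
       (\<exists>W\<subseteq>V. card W = s \<and> homogeneous \<eta> E W)"
      by (elim exE conjE)
    have "\<forall>\<^sub>F i in sequentially. d < pattern_density ((V0 \<circ> k) i) ((E0 \<circ> k) i) (S \<union> Y) H"
      using limit_density[of "S \<union> Y" H] 2(1,2) d unfolding d_def by (intro order_tendstoD(1)) auto
    moreover have "\<forall>\<^sub>F i in sequentially.
        (\<Sum>e\<in>[S]\<^bsup>3\<^esup>. pattern_density ((V0 \<circ> k) i) ((E0 \<circ> k) i) (e \<union> Y) (sym_diff H {e})) < d / 4"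
    proof (rule order_tendstoD(2))
      show "(\<lambda>i. \<Sum>e\<in>[S]\<^bsup>3\<^esup>. pattern_density ((V0 \<circ> k) i) ((E0 \<circ> k) i) (e \<union> Y) (sym_diff H {e})) \<longlonglongrightarrow>
          (\<Sum>e\<in>[S]\<^bsup>3\<^esup>. limit_density (e \<union> Y) (sym_diff H {e}))"
        using 2(2) by (intro tendsto_sum limit_density) (simp add: nsets_def)
      have "limit_density (e \<union> Y) (sym_diff H {e}) \<le> 0" if "e \<in> [S]\<^bsup>3\<^esup>" for e
        using 2(6) that unfolding locked_def by (simp add: not_less)
      then have "(\<Sum>e\<in>[S]\<^bsup>3\<^esup>. limit_density (e \<union> Y) (sym_diff H {e})) \<le> 0" by (rule sum_nonpos)
      then show "(\<Sum>e\<in>[S]\<^bsup>3\<^esup>. limit_density (e \<union> Y) (sym_diff H {e})) < d / 4" using d by simp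
    qed
    moreover have "\<forall>\<^sub>F i in sequentially. 2 / c < real i"
      using filterlim_real_sequentially by (simp add: filterlim_at_top_dense)
    ultimately have "\<forall>\<^sub>F i in sequentially. False"
      using cV[of "4 * (card S)\<^sup>2 / d"] lnV[of "4 / c"]
    proof eventually_elim
      case (elim i)
      define L where "L = ln (real (card (V0 (k i))))"
      have L: "4 \<le> c * L" using elim(5) c by (simp add: L_def field_simps)
      \<comment> \<open>From \<open>1 / (k i + 1) \<le> c / 2\<close> there remains a slack of
        \<open>c / 2 * L \<ge> 2\<close>, which absorbs the rounding up of the required
        size.\<close>
      have "2 / c < real (Suc (k i))" using elim(3) seq_suble[OF k, of i] by simp
      then have "1 / real (Suc (k i)) \<le> c / 2" using c by (simp add: field_simps)
      moreover have "0 \<le> L" using L c by (smt (verit) mult_nonneg_nonpos)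
      ultimately have "1 / real (Suc (k i)) * L \<le> c / 2 * L" by (rule mult_right_mono)
      then have s: "real (?s (k i) (V0 (k i))) \<le> c * L"
        using L unfolding L_def[symmetric] by linarith
      have "(card S)\<^sup>2 \<le> d / 4 * card (V0 (k i))" using elim(4) d by (simp add: field_simps)
      moreover have "d \<le> pattern_density (V0 (k i)) (E0 (k i)) (S \<union> Y) H"
        "(\<Sum>e\<in>[S]\<^bsup>3\<^esup>. pattern_density (V0 (k i)) (E0 (k i)) (e \<union> Y) (sym_diff H {e})) \<le> d / 4"
        using elim(1,2) by simp_all
      ultimately have "\<exists>W\<subseteq>V0 (k i). card W = ?s (k i) (V0 (k i)) \<and> homogeneous \<eta> (E0 (k i)) W"
        using L s unfolding L_def
        by (intro hom[THEN spec, THEN spec, THEN spec, THEN mp, THEN mp, THEN mp, THEN mp, THEN mp, THEN mp, THEN mp]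
            fV0 nV0)
      then show False using G0(3) by blast
    qed
    then show False by simp
  qed
qed

end
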